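(* Let $X$ be a tree that is not homeomorphic to the interval $[0,1]$, with $|R(X)|=m$ and $|E(X)|=n$. Then $NC^*(X)$ is homeomorphic to the topological sum (disjoint union) $\mathcal{K}\oplus\left(\bigoplus_{i=1}^{n+2m-2}[0,1)\right)$, where $\mathcal{K}$ is a simple $n$-od.
   Context: A continuum is a compact connected metric space with more than one point; a subcontinuum of $X$ is a nonempty closed connected subset of $X$ (one-point sets are allowed). An arc is a space homeomorphic to $[0,1]$. A finite graph is a continuum that can be written as the union of finitely many arcs, any two of which can intersect in at most one or both of their end points. A tree is a finite graph containing no simple closed curve. The order of a point $p$ in $X$ is the least cardinal $\kappa$ such that $p$ has arbitrarily small neighborhoods with boundary of cardinality $\leq\kappa$; $E(X)$ is the set of endpoints (points of order $1$) and $R(X)$ is the set of ramification points (points of order at least $3$). For an integer $n\ge 3$, a simple $n$-od is a space homeomorphic to the cone over an $n$-point discrete space. $C(X)$ is the set of all subcontinua of $X$, endowed with the Hausdorff metric (equivalently, the Vietoris topology), and $NC^*(X)=\{A\in C(X): X\setminus A \text{ is connected}\}$ with the subspace topology; the empty set counts as connected, so $X\in NC^*(X)$. *)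

theory Defs
  imports "HOL-Analysis.Analysis" "HOL-Library.Extended_Nat"
begin

section \<open>Continua, finite graphs and trees\<close>

text \<open>Spaces are subsets of a metric space type, with the induced metric.\<close>

definition continuum :: "'a::metric_space set \<Rightarrow> bool" where
  "continuum X \<longleftrightarrow> compact X \<and> connected X \<and> (\<exists>x\<in>X. \<exists>y\<in>X. x \<noteq> y)"

definition subcontinuum :: "'a::metric_space set \<Rightarrow> 'a set \<Rightarrow> bool" where
  "subcontinuum X A \<longleftrightarrow> A \<noteq> {} \<and> closedin (top_of_set X) A \<and> connected A"

text \<open>The arcs are given by parametrizations, so that their end points are
  \<^const>\<open>pathstart\<close> and \<^const>\<open>pathfinish\<close>. Distinct members of the family
  cannot parametrize the same arc, since that arc would consist of end points.\<close>

definition finite_graph :: "'a::metric_space set \<Rightarrow> bool" where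
  "finite_graph X \<longleftrightarrow> continuum X \<and>
     (\<exists>G. finite G \<and> (\<forall>g\<in>G. arc g) \<and> X = (\<Union>g\<in>G. path_image g) \<and>
        (\<forall>g\<in>G. \<forall>h\<in>G. g \<noteq> h \<longrightarrow>
           path_image g \<inter> path_image h \<subseteq>
             {pathstart g, pathfinish g} \<inter> {pathstart h, pathfinish h}))"

definition simple_closed_curve :: "'a::metric_space set \<Rightarrow> bool" where
  "simple_closed_curve S \<longleftrightarrow> S homeomorphic sphere (0::complex) 1"

definition is_tree :: "'a::metric_space set \<Rightarrow> bool" where
  "is_tree X \<longleftrightarrow> finite_graph X \<and> \<not> (\<exists>S\<subseteq>X. simple_closed_curve S)"


section \<open>Order of a point\<close>

text \<open>All infinite cardinals are collapsed to \<open>\<infinity>\<close>; this does not affect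
  which points have order 1 or order at least 3.\<close>

definition ecard :: "'a set \<Rightarrow> enat" where
  "ecard S = (if finite S then enat (card S) else \<infinity>)"

definition point_order :: "'a::metric_space set \<Rightarrow> 'a \<Rightarrow> enat" where
  "point_order X p =
     (LEAST k. \<forall>U. openin (top_of_set X) U \<and> p \<in> U \<longrightarrow>
        (\<exists>V. openin (top_of_set X) V \<and> p \<in> V \<and> V \<subseteq> U \<and>
             ecard (top_of_set X frontier_of V) \<le> k))"

definition endpoints :: "'a::metric_space set \<Rightarrow> 'a set" where
  "endpoints X = {p \<in> X. point_order X p = 1}"

definition ramification_points :: "'a::metric_space set \<Rightarrow> 'a set" where
  "ramification_points X = {p \<in> X. point_order X p \<ge> 3}"


section \<open>Hyperspaces\<close>

text \<open>The value 0 outside the nonempty bounded sets only serves to make the function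
  total, nonnegative and symmetric, as \<^locale>\<open>Metric_space\<close> demands.\<close>

definition hausdorff_dist :: "'a::metric_space set \<Rightarrow> 'a set \<Rightarrow> real" where
  "hausdorff_dist A B =
     (if A \<noteq> {} \<and> B \<noteq> {} \<and> bounded A \<and> bounded B
      then max (SUP a\<in>A. infdist a B) (SUP b\<in>B. infdist b A) else 0)"

definition hyper_C :: "'a::metric_space set \<Rightarrow> 'a set set" where
  "hyper_C X = {A. subcontinuum X A}"

definition hyper_C_topology :: "'a::metric_space set \<Rightarrow> 'a set topology" where
  "hyper_C_topology X = Metric_space.mtopology (hyper_C X) hausdorff_dist"

definition NC_star :: "'a::metric_space set \<Rightarrow> 'a set set" where
  "NC_star X = {A \<in> hyper_C X. connected (X - A)}"

definition NC_star_topology :: "'a::metric_space set \<Rightarrow> 'a set topology" where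
  "NC_star_topology X = subtopology (hyper_C_topology X) (NC_star X)"

lemma bdd_above_infdist:
  assumes "bounded A" "B \<noteq> {}"
  shows "bdd_above ((\<lambda>a. infdist a B) ` A)"
proof -
  obtain b where b: "b \<in> B" using assms by auto
  obtain e where e: "\<And>a. a \<in> A \<Longrightarrow> dist b a \<le> e"
    using assms(1) bounded_any_center by metis
  show ?thesis
    by (rule bdd_aboveI2[where M=e]) (metis b e infdist_le2 dist_commute)
qed

lemma hausdorff_dist_le_iff:
  assumes "A \<noteq> {}" "B \<noteq> {}" "bounded A" "bounded B"
  shows "hausdorff_dist A B \<le> r \<longleftrightarrow> (\<forall>a\<in>A. infdist a B \<le> r) \<and> (\<forall>b\<in>B. infdist b A \<le> r)"
  using assms by (simp add: hausdorff_dist_def cSUP_le_iff bdd_above_infdist)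

lemma hausdorff_dist_nonneg: "0 \<le> hausdorff_dist A B"
proof (cases "A \<noteq> {} \<and> B \<noteq> {} \<and> bounded A \<and> bounded B")
  case True
  then obtain a where "a \<in> A" by auto
  with True show ?thesis
    using hausdorff_dist_le_iff[of A B "hausdorff_dist A B"] infdist_nonneg[of a B] by force
qed (auto simp: hausdorff_dist_def)

lemma infdist_le_add:
  assumes "B \<noteq> {}" "\<And>b. b \<in> B \<Longrightarrow> infdist b C \<le> s"
  shows "infdist a C \<le> infdist a B + s"
proof -
  have "infdist a C - s \<le> (INF b\<in>B. dist a b)"
  proof (rule cINF_greatest[OF assms(1)])
    fix b assume "b \<in> B"
    then show "infdist a C - s \<le> dist a b"
      using infdist_triangle[of a C b] assms(2)[of b] by linarith
  qed
  then show ?thesis using assms(1) by (simp add: infdist_notempty)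
qed

lemma Metric_space_hyper_C:
  assumes "compact X"
  shows "Metric_space (hyper_C X) hausdorff_dist"
proof
  have *: "A \<noteq> {} \<and> bounded A \<and> closed A" if "A \<in> hyper_C X" for A
    using that assms
    by (auto simp: hyper_C_def subcontinuum_def closedin_compact compact_imp_bounded
        compact_imp_closed)
  fix A B C :: "'a set"
  show "0 \<le> hausdorff_dist A B" by (rule hausdorff_dist_nonneg)
  show "hausdorff_dist A B = hausdorff_dist B A"
    by (auto simp: hausdorff_dist_def max.commute)
  assume A: "A \<in> hyper_C X" and B: "B \<in> hyper_C X"
  note AB = *[OF A] *[OF B]
  have "hausdorff_dist A B \<le> 0 \<longleftrightarrow> (\<forall>a\<in>A. infdist a B = 0) \<and> (\<forall>b\<in>B. infdist b A = 0)"
    using AB by (simp add: hausdorff_dist_le_iff infdist_nonneg antisym_conv)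
  also have "\<dots> \<longleftrightarrow> A = B"
    using AB by (auto simp flip: in_closed_iff_infdist_zero)
  finally show "hausdorff_dist A B = 0 \<longleftrightarrow> A = B"
    using hausdorff_dist_nonneg[of A B] by linarith
  assume C: "C \<in> hyper_C X"
  note ABC = AB *[OF C]
  have 1: "\<And>a. a \<in> A \<Longrightarrow> infdist a B \<le> hausdorff_dist A B"
       "\<And>b. b \<in> B \<Longrightarrow> infdist b A \<le> hausdorff_dist A B"
       "\<And>b. b \<in> B \<Longrightarrow> infdist b C \<le> hausdorff_dist B C"
       "\<And>c. c \<in> C \<Longrightarrow> infdist c B \<le> hausdorff_dist B C"
    using ABC hausdorff_dist_le_iff[of A B "hausdorff_dist A B"]
      hausdorff_dist_le_iff[of B C "hausdorff_dist B C"] by auto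
  have "infdist a C \<le> hausdorff_dist A B + hausdorff_dist B C" if "a \<in> A" for a
    using infdist_le_add[of B C "hausdorff_dist B C" a] 1(1)[OF that] 1(3) ABC by force
  moreover have "infdist c A \<le> hausdorff_dist A B + hausdorff_dist B C" if "c \<in> C" for c
    using infdist_le_add[of B A "hausdorff_dist A B" c] 1(4)[OF that] 1(2) ABC by force
  ultimately show "hausdorff_dist A C \<le> hausdorff_dist A B + hausdorff_dist B C"
    using ABC by (simp add: hausdorff_dist_le_iff)
qed


section \<open>Cones and simple n-ods\<close>

text \<open>The quotient \<open>(Y \<times> [0,1]) / (Y \<times> {1})\<close>; \<open>cone_class Y\<close> sends a point to
  its equivalence class.\<close>

definition cone_class :: "'a topology \<Rightarrow> 'a \<times> real \<Rightarrow> ('a \<times> real) set" where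
  "cone_class Y z = (if snd z = 1 then topspace Y \<times> {1} else {z})"

definition cone_topology :: "'a topology \<Rightarrow> ('a \<times> real) set topology" where
  "cone_topology Y =
     topology (\<lambda>U. U \<subseteq> cone_class Y ` (topspace Y \<times> {0..1}) \<and>
       openin (prod_topology Y (top_of_set {0..1}))
              {z \<in> topspace Y \<times> {0..1}. cone_class Y z \<in> U})"

lemma openin_cone_topology:
  "openin (cone_topology Y) U \<longleftrightarrow>
     U \<subseteq> cone_class Y ` (topspace Y \<times> {0..1}) \<and>
     openin (prod_topology Y (top_of_set {0..1}))
            {z \<in> topspace Y \<times> {0..1}. cone_class Y z \<in> U}" (is "_ \<longleftrightarrow> ?P U")
proof -
  let ?pre = "\<lambda>U. {z \<in> topspace Y \<times> {0..1}. cone_class Y z \<in> U}"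
  have "istopology ?P"
    unfolding istopology_def
  proof (rule conjI; intro allI impI)
    fix S T assume S: "?P S" and T: "?P T"
    have eq: "?pre (S \<inter> T) = ?pre S \<inter> ?pre T" by blast
    show "?P (S \<inter> T)"
      unfolding eq using S T by (meson openin_Int inf.coboundedI1)
  next
    fix K assume K: "\<forall>S\<in>K. ?P S"
    have eq: "?pre (\<Union>K) = \<Union>(?pre ` K)" by blast
    show "?P (\<Union>K)"
      unfolding eq
    proof
      show "openin (prod_topology Y (top_of_set {0..1})) (\<Union>(?pre ` K))"
        by (rule openin_Union) (use K in blast)
    qed (use K in blast)
  qed
  then show ?thesis by (simp add: cone_topology_def)
qed

lemma quotient_map_cone_class:
  "quotient_map (prod_topology Y (top_of_set {0..1})) (cone_topology Y) (cone_class Y)"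
proof -
  have "openin (cone_topology Y) (cone_class Y ` (topspace Y \<times> {0..1}))"
    unfolding openin_cone_topology
  proof
    have "{z \<in> topspace Y \<times> {0..1}. cone_class Y z \<in> cone_class Y ` (topspace Y \<times> {0..1})}
        = topspace (prod_topology Y (top_of_set {0..1}))" by auto
    then show "openin (prod_topology Y (top_of_set {0..1})) {z \<in> topspace Y \<times> {0..1}.
        cone_class Y z \<in> cone_class Y ` (topspace Y \<times> {0..1})}"
      by (simp only: openin_topspace)
  qed simp
  then have "cone_class Y ` (topspace Y \<times> {0..1}) \<subseteq> topspace (cone_topology Y)"
    by (rule openin_subset)
  moreover have "topspace (cone_topology Y) \<subseteq> cone_class Y ` (topspace Y \<times> {0..1})"
    using openin_topspace[of "cone_topology Y"] unfolding openin_cone_topology by (rule conjunct1)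
  ultimately have top: "topspace (cone_topology Y) = cone_class Y ` (topspace Y \<times> {0..1})"
    by (rule subset_antisym[rotated])
  then show ?thesis
    unfolding quotient_map_def openin_cone_topology top by simp
qed

definition simple_nod :: "nat \<Rightarrow> 'k topology \<Rightarrow> bool" where
  "simple_nod n K \<longleftrightarrow> 3 \<le> n \<and>
     K homeomorphic_space cone_topology (discrete_topology {..<n})"


section \<open>Topological sum of two spaces\<close>

text \<open>Binary version of \<^const>\<open>sum_topology\<close>, for summands of different types.\<close>

definition plus_topology :: "'a topology \<Rightarrow> 'b topology \<Rightarrow> ('a + 'b) topology" where
  "plus_topology X Y = topology (\<lambda>U. openin X (Inl -` U) \<and> openin Y (Inr -` U))"

lemma openin_plus_topology:
  "openin (plus_topology X Y) U \<longleftrightarrow> openin X (Inl -` U) \<and> openin Y (Inr -` U)"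
proof -
  have "istopology (\<lambda>U. openin X (Inl -` U) \<and> openin Y (Inr -` U))"
    by (auto simp: istopology_def vimage_Union)
  then show ?thesis by (simp add: plus_topology_def)
qed

lemma topspace_plus_topology:
  "topspace (plus_topology X Y) = topspace X <+> topspace Y"
proof -
  have "openin (plus_topology X Y) (topspace X <+> topspace Y)"
  proof -
    have "Inl -` (topspace X <+> topspace Y) = topspace X"
      "Inr -` (topspace X <+> topspace Y) = topspace Y" by auto
    then show ?thesis by (simp add: openin_plus_topology)
  qed
  moreover have "topspace (plus_topology X Y) \<subseteq> topspace X <+> topspace Y"
  proof
    fix x assume x: "x \<in> topspace (plus_topology X Y)"
    have "openin (plus_topology X Y) (topspace (plus_topology X Y))" by simp
    then have "Inl -` topspace (plus_topology X Y) \<subseteq> topspace X"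
      "Inr -` topspace (plus_topology X Y) \<subseteq> topspace Y"
      by (auto simp only: openin_plus_topology dest: openin_subset)
    with x show "x \<in> topspace X <+> topspace Y" by (cases x) auto
  qed
  ultimately show ?thesis by (metis openin_subset subset_antisym)
qed

end

theory Submission
  imports Defs
begin

text \<open>
  Let \<open>A\<close> be a proper subcontinuum of the tree \<open>X\<close> whose complement is connected. The boundary of
  \<open>A\<close> is then a single point \<open>p\<close>, and \<open>A\<close> is the complement of one component of \<open>X - {p}\<close>. So \<open>A\<close>
  is determined by \<open>p\<close> and a direction at \<open>p\<close>, in other words by a directed edge \<open>d\<close> of the tree
  and a parameter \<open>t < 1\<close> with \<open>p = d t\<close>: it is the set \<open>upto d t\<close> of all points that are not
  beyond \<open>d t\<close> in the direction of \<open>d\<close> (\<open>NC_star_cases\<close>, \<open>upto_inj\<close>). These sets vary continuously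
  with \<open>t\<close>, so each directed edge contributes one half-open interval to the space \<open>NC_star X\<close>.

  What happens for \<open>t = 1\<close> depends on the vertex at which \<open>d\<close> ends. If it is an endpoint of \<open>X\<close>,
  then \<open>upto d 1 = X\<close>; hence the intervals that belong to the \<open>n\<close> edges directed towards endpoints
  are closed up by the common point \<open>X\<close>, which gives the simple \<open>n\<close>-od. If it is a ramification
  point, then the complement of \<open>upto d 1\<close> falls apart into several branches
  (\<open>upto_1_ramification\<close>), and the interval stays half-open and is closed in \<open>NC_star X\<close>.
  In a decomposition of \<open>X\<close> into as few arcs as possible no vertex has degree 2, the vertices are
  exactly the \<open>n + m\<close> endpoints and ramification points, and there are \<open>n + m - 1\<close> edges
  (\<open>card_directed_edges\<close>). So \<open>2 * (n + m - 1) - n = n + 2 * m - 2\<close> half-open intervals remain.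
  Comparing the number of directed edges with the sum of the degrees also shows that \<open>n \<ge> 3\<close> when
  \<open>X\<close> is not an arc.

  For the homeomorphism, \<open>NC_star X\<close> and the model space are both presented as quotients of one sum
  of intervals, a closed one for each edge directed towards an endpoint and a half-open one for each
  other directed edge (\<open>quotient_upto\<close>, \<open>quotient_cone_plus_sum\<close>). Both quotient maps identify
  the ends of the closed intervals and nothing else.

  The geometric input is that removing an open edge cuts the tree into exactly two pieces
  (\<open>ends_separated\<close>, \<open>sides_cover\<close>): there are at most two since every further piece would be a
  union of edges separated from the rest, and there are two since otherwise an arc outside the edge
  would close it up to a simple closed curve.
\<close>

section \<open>Arcs in finite unions of arcs\<close>

definition subarc :: "real \<Rightarrow> real \<Rightarrow> (real \<Rightarrow> 'a) \<Rightarrow> real \<Rightarrow> 'a" where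
  "subarc u v g = (\<lambda>x. g ((v - u) * x + u))"

lemma subarc_ends [simp]: "pathstart (subarc u v g) = g u" "pathfinish (subarc u v g) = g v"
  by (simp_all add: subarc_def pathstart_def pathfinish_def)

lemma subarc_image:
  assumes "u \<le> v"
  shows "path_image (subarc u v g) = g ` {u..v}"
proof -
  have "(\<lambda>x. (v - u) * x + u) ` {0..1} = {u..v}"
    using assms by (subst image_affinity_atLeastAtMost) auto
  then show ?thesis unfolding path_image_def subarc_def by (metis image_image)
qed

lemma subarc_image_open:
  assumes "u < v"
  shows "subarc u v g ` {0..<1} = g ` {u..<v}"
proof -
  have "(\<lambda>x. (v - u) * x + u) ` {0..<1} = {u..<v}"
  proof safe
    fix x :: real assume x: "x \<in> {0..<1}"
    have "(v - u) * x < (v - u) * 1" using x assms by (intro mult_strict_left_mono) auto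
    then have "(v - u) * x + u < v" by (simp add: algebra_simps)
    then show "(v - u) * x + u \<in> {u..<v}" using x assms by simp
  next
    fix y assume "y \<in> {u..<v}"
    then show "y \<in> (\<lambda>x. (v - u) * x + u) ` {0..<1}"
      using assms by (intro image_eqI[of _ _ "(y - u) / (v - u)"]) (auto simp: field_simps)
  qed
  then show ?thesis unfolding subarc_def by (metis image_image)
qed

lemma arc_subarc:
  fixes g :: "real \<Rightarrow> 'a::topological_space"
  assumes "arc g" "0 \<le> u" "u < v" "v \<le> 1"
  shows "arc (subarc u v g)"
proof -
  let ?f = "\<lambda>x::real. (v - u) * x + u"
  have im: "?f ` {0..1} = {u..v}"
    using assms by (subst image_affinity_atLeastAtMost) auto
  have "continuous_on {0..1} g" "inj_on g {0..1}" using assms(1) by (auto simp: arc_def path_def)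
  then have g: "continuous_on (?f ` {0..1}) g" "inj_on g (?f ` {0..1})"
    unfolding im using assms by (meson atLeastatMost_subset_iff continuous_on_subset inj_on_subset)+
  have "continuous_on {0..1} (g \<circ> ?f)" by (intro continuous_on_compose g continuous_intros)
  moreover have "inj_on ?f {0..1}" using assms(3) by (intro inj_onI) simp
  then have "inj_on (g \<circ> ?f) {0..1}" using g(2) by (rule comp_inj_on)
  ultimately show ?thesis by (simp add: arc_def path_def subarc_def comp_def)
qed

definition arc_joined :: "'a::topological_space set \<Rightarrow> 'a \<Rightarrow> 'a \<Rightarrow> bool" where
  "arc_joined S a b \<longleftrightarrow> a \<in> S \<and> b \<in> S \<and>
     (a = b \<or> (\<exists>p. arc p \<and> path_image p \<subseteq> S \<and> pathstart p = a \<and> pathfinish p = b))"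

lemma arc_joined_mono: "arc_joined S a b \<Longrightarrow> S \<subseteq> T \<Longrightarrow> arc_joined T a b"
  unfolding arc_joined_def by blast

text \<open>Two consecutive arcs may cross many times; following the first one only up to the first
  point where it meets the second one leaves an arc.\<close>

lemma arc_joined_trans:
  fixes S :: "'a::metric_space set"
  assumes "arc_joined S a b" "arc_joined S b c"
  shows "arc_joined S a c"
proof (cases "a = b \<or> b = c \<or> a = c")
  case True
  then show ?thesis using assms by (auto simp: arc_joined_def)
next
  case False
  obtain p where p: "arc p" "path_image p \<subseteq> S" "pathstart p = a" "pathfinish p = b"
    using assms(1) False unfolding arc_joined_def by blast
  obtain q where q: "arc q" "path_image q \<subseteq> S" "pathstart q = b" "pathfinish q = c"
    using assms(2) False unfolding arc_joined_def by blast
  \<comment> \<open>\<open>Inf T\<close> is the parameter at which \<open>p\<close> first meets \<open>q\<close>\<close>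
  define T where "T = {0..1} \<inter> p -` path_image q"
  have "continuous_on {0..1} p" using p(1) by (simp add: arc_def path_def)
  then have "closed T" unfolding T_def
    using q(1) by (intro continuous_closed_preimage)
      (auto simp: compact_imp_closed compact_arc_image)
  moreover have "1 \<in> T"
    using p q by (metis IntI T_def atLeastAtMost_iff order_refl pathfinish_def pathstart_in_path_image vimageI
        zero_le_one)
  moreover have bdd: "bdd_below T" by (auto simp: T_def)
  ultimately have InfT: "Inf T \<in> T" using closed_contains_Inf by blast
  define t where "t = Inf T"
  have t: "0 \<le> t" "t \<le> 1" "p t \<in> path_image q" using InfT by (auto simp: T_def t_def)
  have first: "t \<le> x" if "x \<in> {0..1}" "p x \<in> path_image q" for x
    unfolding t_def using that bdd by (intro cInf_lower) (auto simp: T_def)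
  obtain s where s: "0 \<le> s" "s \<le> 1" "q s = p t" using t(3) by (auto simp: path_image_def)
  have pinj: "inj_on p {0..1}" and qinj: "inj_on q {0..1}" using p q by (auto simp: arc_def)
  have "\<exists>r. arc r \<and> path_image r \<subseteq> S \<and> pathstart r = a \<and> pathfinish r = c"
  proof -
    have q1: "arc (subarc s 1 q)" "path_image (subarc s 1 q) \<subseteq> path_image q" if "s \<noteq> 1"
      using that q s arc_subarc[of q s 1] subarc_image[of s 1 q]
      by (auto simp: path_image_def)
    have p1: "arc (subarc 0 t p)" "path_image (subarc 0 t p) = p ` {0..t}"
      if "t \<noteq> 0"
      using that p t arc_subarc[of p 0 t] subarc_image[of 0 t p] by auto
    have p1': "p ` {0..t} \<subseteq> path_image p" using t by (auto simp: path_image_def)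
    consider "t = 0" | "t \<noteq> 0" "s = 1" | "t \<noteq> 0" "s \<noteq> 1" by blast
    then show ?thesis
    proof cases
      case 1
      then have "s \<noteq> 1" using s p q False by (auto simp: pathstart_def pathfinish_def)
      with q1 1 s p q show ?thesis
        by (intro exI[of _ "subarc s 1 q"])
          (auto simp: pathstart_def pathfinish_def subarc_def)
    next
      case 2
      with p1 p1' s p q show ?thesis
        by (intro exI[of _ "subarc 0 t p"])
          (auto simp: pathstart_def pathfinish_def subarc_def)
    next
      case 3
      have "p ` {0..t} \<inter> path_image q \<subseteq> {p t}"
        using first t by fastforce
      then have "arc (subarc 0 t p +++ subarc s 1 q)"
        using 3 p1 q1 s by (intro arc_join) auto
      moreover have "path_image (subarc 0 t p +++ subarc s 1 q) \<subseteq> S"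
        using p1 q1 3 p1' p q path_image_join_subset[of "subarc 0 t p" "subarc s 1 q"] by blast
      ultimately show ?thesis
        using p q by (intro exI[of _ "subarc 0 t p +++ subarc s 1 q"])
          (auto simp: pathstart_def pathfinish_def subarc_def joinpaths_def)
    qed
  qed
  then show ?thesis using assms by (auto simp: arc_joined_def)
qed

lemma arc_joined_sym:
  fixes S :: "'a::topological_space set"
  assumes "arc_joined S a b"
  shows "arc_joined S b a"
  using assms unfolding arc_joined_def
  by (metis arc_reversepath path_image_reversepath pathfinish_reversepath pathstart_reversepath)

lemma arc_joined_arc:
  fixes p :: "real \<Rightarrow> 'a::topological_space"
  assumes "arc p" "a \<in> path_image p" "b \<in> path_image p"
  shows "arc_joined (path_image p) a b"
proof (cases "a = b")
  case False
  obtain s t where st: "s \<in> {0..1}" "t \<in> {0..1}" "p s = a" "p t = b"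
    using assms by (auto simp: path_image_def)
  have less: "arc_joined (path_image p) (p u) (p v)"
    if "u \<in> {0..1}" "v \<in> {0..1}" "u < v" for u v
  proof -
    have "path_image (subarc u v p) \<subseteq> path_image p"
      using that subarc_image[of u v p] by (auto simp: path_image_def)
    then show ?thesis
      using that assms arc_subarc[of p u v] unfolding arc_joined_def
      by (auto intro!: exI[of _ "subarc u v p"] simp: path_image_def)
  qed
  have "s \<noteq> t" using st False by auto
  then show ?thesis
    using less[of s t] less[of t s] st arc_joined_sym by (metis linorder_neqE_linordered_idom)
qed (use assms in \<open>auto simp: arc_joined_def\<close>)

text \<open>The pieces inside \<open>S\<close> and the pieces outside \<open>S\<close> form two disjoint closed sets that cover \<open>C\<close>.\<close>

lemma connected_subset_saturated:
  fixes C :: "'a::topological_space set"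
  assumes "finite P" "\<And>K. K \<in> P \<Longrightarrow> closed K" "connected C" "C \<subseteq> \<Union>P"
    and "\<And>K. K \<in> P \<Longrightarrow> K \<inter> S \<noteq> {} \<Longrightarrow> K \<subseteq> S" and "C \<inter> S \<noteq> {}"
  shows "C \<subseteq> S"
proof (rule ccontr)
  assume "\<not> C \<subseteq> S"
  define A where "A = \<Union>{K \<in> P. K \<subseteq> S}"
  define B where "B = \<Union>{K \<in> P. K \<inter> S = {}}"
  have "closed A" "closed B" unfolding A_def B_def using assms(1,2) by auto
  moreover have "C \<subseteq> A \<union> B" unfolding A_def B_def using assms(4,5) by fast
  moreover have "A \<inter> C \<noteq> {}" "B \<inter> C \<noteq> {}" "A \<inter> B \<inter> C = {}"
    using assms(4-6) \<open>\<not> C \<subseteq> S\<close> unfolding A_def B_def by blast+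
  ultimately show False using assms(3) unfolding connected_closed by blast
qed

text \<open>In a finite union of closed pieces that are arcwise connected, the points that can be reached by
  an arc from a given point form a union of some of the pieces.\<close>

lemma arc_joined_in_finite_union:
  fixes Y :: "'a::metric_space set"
  assumes "finite P" "\<And>K. K \<in> P \<Longrightarrow> closed K"
    and joined: "\<And>K x y. K \<in> P \<Longrightarrow> x \<in> K \<Longrightarrow> y \<in> K \<Longrightarrow> arc_joined K x y"
    and "Y = \<Union>P" "connected C" "C \<subseteq> Y" "a \<in> C" "b \<in> C"
  shows "arc_joined Y a b"
proof -
  have "C \<subseteq> {x. arc_joined Y a x}"
  proof (rule connected_subset_saturated[OF assms(1,2) assms(5)])
    fix K assume K: "K \<in> P" "K \<inter> {x. arc_joined Y a x} \<noteq> {}"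
    then obtain y where "y \<in> K" "arc_joined Y a y" by blast
    moreover have "K \<subseteq> Y" using K assms by blast
    ultimately show "K \<subseteq> {x. arc_joined Y a x}"
      using joined K(1) arc_joined_trans arc_joined_mono by blast
  next
    have "arc_joined Y a a" using assms by (auto simp: arc_joined_def)
    then show "C \<inter> {x. arc_joined Y a x} \<noteq> {}"
      using assms by blast
  next
    show "C \<subseteq> \<Union>P" using assms by simp
  qed
  then show ?thesis using assms by blast
qed


section \<open>The order of the centre of a star\<close>

text \<open>A neighbourhood of \<open>p\<close> that consists of finitely many arcs issuing from \<open>p\<close>. The far ends of the
  arcs may be limits of other points of \<open>X\<close>, so openness is required without them.\<close>

definition star :: "'a::metric_space set \<Rightarrow> 'a \<Rightarrow> (real \<Rightarrow> 'a) set \<Rightarrow> bool" where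
  "star X p D \<longleftrightarrow> finite D \<and> D \<noteq> {} \<and> (\<forall>d\<in>D. arc d \<and> pathstart d = p \<and> path_image d \<subseteq> X) \<and>
     (\<forall>d\<in>D. \<forall>e\<in>D. d \<noteq> e \<longrightarrow> path_image d \<inter> path_image e = {p}) \<and>
     openin (top_of_set X) (\<Union>d\<in>D. d ` {0..<1})"

lemma arc_image_eq_iff:
  "arc d \<Longrightarrow> s \<in> {0..1} \<Longrightarrow> t \<in> {0..1} \<Longrightarrow> d s = d t \<longleftrightarrow> s = t"
  unfolding arc_def by (meson inj_onD)

lemma arc_imp_continuous_on: "arc d \<Longrightarrow> continuous_on {0..1} d"
  by (simp add: arc_def path_def)

lemma arc_compact_segment:
  fixes d :: "real \<Rightarrow> 'a::metric_space"
  assumes "arc d" "0 \<le> s" "t \<le> 1"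
  shows "compact (d ` {s..t})"
  using assms by (intro compact_continuous_image)
    (auto intro: continuous_on_subset[OF arc_imp_continuous_on])

lemma arc_connected_image:
  assumes "arc d" "is_interval I" "I \<subseteq> {0..1}"
  shows "connected (d ` I)"
  using assms by (intro connected_continuous_image)
    (auto intro: continuous_on_subset[OF arc_imp_continuous_on] is_interval_connected)

text \<open>The first half of each arc is connected and leaves the neighbourhood \<open>V\<close>, so it contains a
  boundary point of \<open>V\<close>; since the arcs share only \<open>p\<close>, these points are distinct.\<close>

lemma star_order_lower:
  assumes "star X p D" "openin (top_of_set X) V" "p \<in> V" "V \<subseteq> X - (\<lambda>d. d (1/2)) ` D"
  shows "enat (card D) \<le> ecard (top_of_set X frontier_of V)"
proof -
  let ?F = "top_of_set X frontier_of V"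
  note D = assms(1)[unfolded star_def]
  have "\<exists>x. x \<in> ?F \<inter> path_image d \<and> x \<noteq> p" if d: "d \<in> D" for d
  proof -
    let ?S = "d ` {0..1/2}"
    have a: "arc d" "pathstart d = p" "path_image d \<subseteq> X" using D d by auto
    have "?S \<subseteq> X" using a by (auto simp: path_image_def)
    moreover have "connected ?S" using a by (intro arc_connected_image) (auto simp: is_interval_cc)
    ultimately have "connectedin (top_of_set X) ?S" by (simp add: connectedin_subtopology)
    moreover have "p \<in> ?S \<inter> V" using a assms(3) by (force simp: pathstart_def)
    moreover have "d (1/2) \<in> ?S - V" using assms(4) d by auto
    ultimately obtain x where "x \<in> ?S" "x \<in> ?F"
      using connectedin_Int_frontier_of by (metis disjoint_iff empty_iff)
    moreover have "V \<inter> ?F = {}"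
      using assms(2) by (metis frontier_of_disjoint_eq inf_commute openin_subset)
    ultimately show ?thesis using assms(3) by (intro exI[of _ x]) (auto simp: path_image_def)
  qed
  then obtain f where f: "\<And>d. d \<in> D \<Longrightarrow> f d \<in> ?F \<inter> path_image d \<and> f d \<noteq> p" by metis
  have "inj_on f D"
  proof (rule inj_onI, rule ccontr)
    fix d e assume "d \<in> D" "e \<in> D" "f d = f e" "d \<noteq> e"
    moreover have "path_image d \<inter> path_image e = {p}" using D calculation by blast
    ultimately show False using f[of d] f[of e] by auto
  qed
  then have "card D \<le> card ?F" if "finite ?F"
    using f that by (intro card_inj_on_le[of f]) auto
  then show ?thesis by (simp add: ecard_def)
qed

text \<open>Cutting all arcs at the same small parameter \<open>t\<close> leaves a neighbourhood of \<open>p\<close> whose boundary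
  points are among the points \<open>d t\<close>.\<close>

lemma star_order_upper:
  assumes "star X p D" "openin (top_of_set X) U" "p \<in> U"
  shows "\<exists>V. openin (top_of_set X) V \<and> p \<in> V \<and> V \<subseteq> U \<and>
    ecard (top_of_set X frontier_of V) \<le> enat (card D)"
proof -
  note D = assms(1)[unfolded star_def]
  have "\<exists>\<epsilon>>0. \<epsilon> < 1 \<and> d ` {0..<\<epsilon>} \<subseteq> U" if d: "d \<in> D" for d
  proof -
    have a: "arc d" "pathstart d = p" "path_image d \<subseteq> X" using D d by auto
    obtain W where W: "open W" "U = X \<inter> W" using assms(2) by (auto simp: openin_open)
    obtain r where r: "r > 0" "ball p r \<subseteq> W" using W assms(3) openE by blast
    have "continuous_on {0..1} d" using a by (simp add: arc_imp_continuous_on)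
    then obtain \<delta> where \<delta>: "\<delta> > 0" "\<And>x. x \<in> {0..1} \<Longrightarrow> dist x 0 < \<delta> \<Longrightarrow> dist (d x) (d 0) < r"
      using r(1) unfolding continuous_on_iff by (metis atLeastAtMost_iff order_refl zero_le_one)
    have "d ` {0..<min \<delta> (1/2)} \<subseteq> U"
    proof
      fix y assume "y \<in> d ` {0..<min \<delta> (1/2)}"
      then obtain x where x: "0 \<le> x" "x < \<delta>" "x < 1/2" "y = d x" by auto
      then have "dist (d x) p < r" using \<delta>(2)[of x] a by (auto simp: pathstart_def)
      moreover have "y \<in> X" using x a by (auto simp: path_image_def)
      ultimately show "y \<in> U" using W r x by (auto simp: dist_commute subset_iff)
    qed
    then show ?thesis using \<delta> by (intro exI[of _ "min \<delta> (1/2)"]) auto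
  qed
  then obtain \<epsilon> where \<epsilon>: "\<And>d. d \<in> D \<Longrightarrow> \<epsilon> d > (0::real) \<and> \<epsilon> d < 1 \<and> d ` {0..<\<epsilon> d} \<subseteq> U" by metis
  define t where "t = Min (\<epsilon> ` D)"
  have t: "t > 0" "t < 1" "\<And>d. d \<in> D \<Longrightarrow> t \<le> \<epsilon> d"
  proof -
    have fin: "finite (\<epsilon> ` D)" "\<epsilon> ` D \<noteq> {}" using D by auto
    then have "t \<in> \<epsilon> ` D" unfolding t_def by (rule Min_in)
    then show "t > 0" "t < 1" using \<epsilon> by auto
    show "t \<le> \<epsilon> d" if "d \<in> D" for d unfolding t_def using fin that by (intro Min_le) auto
  qed
  define V where "V = (\<Union>d\<in>D. d ` {0..<t})"
  have p0: "p = d 0" if "d \<in> D" for d using D that by (auto simp: pathstart_def)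
  have inX: "d x \<in> X" if "d \<in> D" "0 \<le> x" "x \<le> 1" for d x
  proof -
    have "d x \<in> path_image d" unfolding path_image_def using that by (intro imageI) simp
    moreover have "path_image d \<subseteq> X" using D that by simp
    ultimately show ?thesis by (rule subsetD[rotated])
  qed
  have eq: "d = e \<and> x = y \<or> d x = p \<and> x = 0 \<and> y = 0"
    if "d \<in> D" "e \<in> D" "d x = e y" "0 \<le> x" "x \<le> 1" "0 \<le> y" "y \<le> 1" for d e x y
  proof (cases "d = e")
    case True
    then show ?thesis using that D arc_image_eq_iff[of d x y] by auto
  next
    case False
    have "d x \<in> path_image d" "e y \<in> path_image e"
      unfolding path_image_def using that by (intro imageI; simp)+
    then have "d x \<in> path_image d \<inter> path_image e" using that by simp
    then have "d x = p" using False D that by blast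
    moreover have "arc d" "arc e" using D that by auto
    ultimately have "x = 0" "y = 0"
      using that p0[of d] p0[of e] arc_image_eq_iff[of d x 0] arc_image_eq_iff[of e y 0] by simp_all
    then show ?thesis using \<open>d x = p\<close> by simp
  qed
  have "openin (top_of_set X) V"
  proof -
    have "closed (\<Union>d\<in>D. d ` {t..1})"
      using D t by (intro closed_UN) (auto intro!: compact_imp_closed arc_compact_segment)
    then have "openin (top_of_set X) (X \<inter> - (\<Union>d\<in>D. d ` {t..1}))"
      by (intro openin_open_Int open_Compl)
    then have "openin (top_of_set X) ((\<Union>d\<in>D. d ` {0..<1}) \<inter> (X \<inter> - (\<Union>d\<in>D. d ` {t..1})))"
      by (rule openin_Int[rotated]) (use D in simp)
    moreover have "V = (\<Union>d\<in>D. d ` {0..<1}) \<inter> (X \<inter> - (\<Union>d\<in>D. d ` {t..1}))"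
    proof
      show "V \<subseteq> (\<Union>d\<in>D. d ` {0..<1}) \<inter> (X \<inter> - (\<Union>d\<in>D. d ` {t..1}))"
      proof
        fix y assume "y \<in> V"
        then obtain d x where dx: "d \<in> D" "0 \<le> x" "x < t" "y = d x" by (auto simp: V_def)
        have "y \<noteq> e z" if "e \<in> D" "t \<le> z" "z \<le> 1" for e z
          using eq[of d e x z] that dx t by auto
        then show "y \<in> (\<Union>d\<in>D. d ` {0..<1}) \<inter> (X \<inter> - (\<Union>d\<in>D. d ` {t..1}))"
          using dx t inX[of d x] by force
      qed
      show "(\<Union>d\<in>D. d ` {0..<1}) \<inter> (X \<inter> - (\<Union>d\<in>D. d ` {t..1})) \<subseteq> V"
      proof
        fix y assume y: "y \<in> (\<Union>d\<in>D. d ` {0..<1}) \<inter> (X \<inter> - (\<Union>d\<in>D. d ` {t..1}))"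
        then obtain d x where dx: "d \<in> D" "0 \<le> x" "x < 1" "y = d x" by auto
        have "\<not> t \<le> x"
        proof
          assume "t \<le> x"
          then have "d x \<in> d ` {t..1}" using dx by (intro imageI) simp
          then have "y \<in> (\<Union>d\<in>D. d ` {t..1})" unfolding dx(4) by (rule UN_I[OF dx(1)])
          then show False using y by simp
        qed
        then have "d x \<in> d ` {0..<t}" using dx by (intro imageI) simp
        then show "y \<in> V" unfolding V_def dx(4) by (rule UN_I[OF dx(1)])
      qed
    qed
    ultimately show ?thesis by simp
  qed
  moreover have "p \<in> V"
  proof -
    obtain d where d: "d \<in> D" using D by auto
    then have "p \<in> d ` {0..<t}" using p0[OF d] t by (intro image_eqI[of _ _ 0]) auto
    then show ?thesis unfolding V_def by (rule UN_I[OF d])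
  qed
  moreover have "V \<subseteq> U"
  proof -
    have "d ` {0..<t} \<subseteq> d ` {0..<\<epsilon> d}" if "d \<in> D" for d
      using t(3)[OF that] by (intro image_mono) auto
    then show ?thesis using \<epsilon> unfolding V_def by (intro UN_least) (meson order_trans)
  qed
  moreover have "ecard (top_of_set X frontier_of V) \<le> enat (card D)"
  proof -
    have "closed (\<Union>d\<in>D. d ` {0..t})"
      using D t by (intro closed_UN) (auto intro!: compact_imp_closed arc_compact_segment)
    then have "closedin (top_of_set X) (X \<inter> (\<Union>d\<in>D. d ` {0..t}))" by (rule closedin_closed_Int)
    moreover have "V \<subseteq> X \<inter> (\<Union>d\<in>D. d ` {0..t})"
    proof -
      have "V \<subseteq> X" using inX t by (auto simp: V_def)
      moreover have "V \<subseteq> (\<Union>d\<in>D. d ` {0..t})"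
        unfolding V_def by (intro UN_mono image_mono) auto
      ultimately show ?thesis by simp
    qed
    ultimately have "top_of_set X closure_of V \<subseteq> (\<Union>d\<in>D. d ` {0..t})"
      by (meson closure_of_minimal inf.boundedE)
    moreover have "(top_of_set X) interior_of V = V"
      using \<open>openin (top_of_set X) V\<close> by (simp add: interior_of_openin)
    ultimately have "top_of_set X frontier_of V \<subseteq> (\<Union>d\<in>D. d ` {0..t}) - V"
      by (auto simp: frontier_of_def)
    also have "\<dots> \<subseteq> (\<lambda>d. d t) ` D"
    proof
      fix y assume y: "y \<in> (\<Union>d\<in>D. d ` {0..t}) - V"
      then obtain d x where dx: "d \<in> D" "0 \<le> x" "x \<le> t" "y = d x" by auto
      have "\<not> x < t"
      proof
        assume "x < t"
        then have "d x \<in> d ` {0..<t}" using dx by (intro imageI) simp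
        then have "y \<in> V" unfolding V_def dx(4) by (rule UN_I[OF dx(1)])
        then show False using y by simp
      qed
      then show "y \<in> (\<lambda>d. d t) ` D" using dx by auto
    qed
    finally have sub: "top_of_set X frontier_of V \<subseteq> (\<lambda>d. d t) ` D" .
    moreover have "finite D" using D by simp
    ultimately have "finite (top_of_set X frontier_of V)"
      "card (top_of_set X frontier_of V) \<le> card D"
      using finite_surj surj_card_le by blast+
    then show ?thesis by (simp add: ecard_def)
  qed
  ultimately show ?thesis by blast
qed

lemma point_order_star:
  assumes "star X p D"
  shows "point_order X p = enat (card D)"
  unfolding point_order_def
proof (rule Least_equality)
  show "\<forall>U. openin (top_of_set X) U \<and> p \<in> U \<longrightarrow>
      (\<exists>V. openin (top_of_set X) V \<and> p \<in> V \<and> V \<subseteq> U \<and>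
           ecard (top_of_set X frontier_of V) \<le> enat (card D))"
    using star_order_upper[OF assms] by blast
next
  note D = assms[unfolded star_def]
  fix k
  assume k: "\<forall>U. openin (top_of_set X) U \<and> p \<in> U \<longrightarrow>
      (\<exists>V. openin (top_of_set X) V \<and> p \<in> V \<and> V \<subseteq> U \<and> ecard (top_of_set X frontier_of V) \<le> k)"
  let ?U = "X - (\<lambda>d. d (1/2)) ` D"
  have "finite ((\<lambda>d. d (1/2)) ` D)" using D by simp
  then have "openin (top_of_set X) ?U"
    by (subst Diff_eq, intro openin_open_Int open_Compl finite_imp_closed)
  moreover have "p \<in> ?U"
  proof -
    have "p \<in> X" using D by (metis all_not_in_conv pathstart_in_path_image subsetD)
    moreover have "p \<noteq> d (1/2)" if "d \<in> D" for d
    proof -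
      have "arc d" "d 0 = p" using D that by (simp_all add: pathstart_def)
      then show ?thesis using arc_image_eq_iff[of d 0 "1/2"] by auto
    qed
    ultimately show ?thesis by auto
  qed
  ultimately have "\<exists>V. openin (top_of_set X) V \<and> p \<in> V \<and> V \<subseteq> ?U \<and>
      ecard (top_of_set X frontier_of V) \<le> k"
    by (intro k[rule_format] conjI)
  then show "enat (card D) \<le> k"
    using star_order_lower[OF assms] by (elim exE conjE) (rule order_trans)
qed

section \<open>Trees cut along an open edge\<close>

text \<open>\<open>D\<close> contains each arc of the decomposition together with its reversal, since the branches of the
  tree at a point correspond to the directions along the edges through it.\<close>

locale arc_tree =
  fixes X :: "'a::metric_space set" and D :: "(real \<Rightarrow> 'a) set"
  assumes finite_D: "finite D"
    and arcs: "d \<in> D \<Longrightarrow> arc d"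
    and rev: "d \<in> D \<Longrightarrow> reversepath d \<in> D"
    and union: "X = (\<Union>d\<in>D. path_image d)"
    and meet: "d \<in> D \<Longrightarrow> e \<in> D \<Longrightarrow> e \<noteq> d \<Longrightarrow> e \<noteq> reversepath d \<Longrightarrow>
      path_image d \<inter> path_image e \<subseteq> {pathstart d, pathfinish d} \<inter> {pathstart e, pathfinish e}"
    and conn: "connected X"
    and no_circle: "\<not> (\<exists>S\<subseteq>X. simple_closed_curve S)"
begin

definition inner :: "(real \<Rightarrow> 'a) \<Rightarrow> 'a set" where
  "inner d = d ` {0<..<1}"

text \<open>Removing the open edge leaves two components: \<open>side d\<close> is the one behind \<open>d\<close>, and
  \<open>side (reversepath d)\<close> the one ahead.\<close>

definition side :: "(real \<Rightarrow> 'a) \<Rightarrow> 'a set" where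
  "side d = connected_component_set (X - inner d) (pathstart d)"

definition vertices :: "'a set" where
  "vertices = pathstart ` D"

lemma inner_reversepath [simp]: "inner (reversepath d) = inner d"
proof -
  have "(\<lambda>x::real. 1 - x) ` {0<..<1} = {0<..<1}"
    by (auto intro!: image_eqI[of _ _ "1 - _"])
  then show ?thesis unfolding inner_def reversepath_def by (metis image_image)
qed

lemma path_image_inner: "path_image d = insert (pathstart d) (insert (pathfinish d) (inner d))"
proof -
  have "{0..1::real} = insert 0 (insert 1 {0<..<1})" by auto
  then show ?thesis unfolding path_image_def inner_def pathstart_def pathfinish_def by simp
qed

lemma ends_not_inner:
  assumes "d \<in> D"
  shows "pathstart d \<noteq> pathfinish d" "pathstart d \<notin> inner d" "pathfinish d \<notin> inner d"
proof -
  have "arc d" using assms arcs by simp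
  note * = arc_image_eq_iff[OF this]
  show "pathstart d \<noteq> pathfinish d" "pathstart d \<notin> inner d" "pathfinish d \<notin> inner d"
    using * by (force simp: pathstart_def pathfinish_def inner_def)+
qed

lemma reversepath_neq: "d \<in> D \<Longrightarrow> reversepath d \<noteq> d"
  using ends_not_inner(1) by (metis pathstart_reversepath)

lemma edge_subset: "d \<in> D \<Longrightarrow> path_image d \<subseteq> X"
  using union by blast

lemma inner_subset: "d \<in> D \<Longrightarrow> inner d \<subseteq> X"
  using edge_subset path_image_inner by blast

lemma inner_avoids_edge:
  assumes "d \<in> D" "e \<in> D" "e \<noteq> d" "e \<noteq> reversepath d"
  shows "path_image e \<inter> inner d = {}"
  using meet[OF assms] ends_not_inner[OF assms(1)] path_image_inner[of d] by blast

lemma edge_connected: "d \<in> D \<Longrightarrow> connected (path_image d)"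
  using arcs by (simp add: arc_imp_path connected_path_image)

lemma edge_closed: "d \<in> D \<Longrightarrow> closed (path_image d)"
  using arcs by (simp add: compact_arc_image compact_imp_closed)

text \<open>The space without an open edge as a finite union of closed connected sets. The two ends are listed
  separately since an end at which no other edge arrives lies in no other edge.\<close>

definition pieces :: "(real \<Rightarrow> 'a) \<Rightarrow> 'a set set" where
  "pieces d = insert {pathstart d} (insert {pathfinish d} (path_image ` (D - {d, reversepath d})))"

lemma finite_pieces: "finite (pieces d)"
  using finite_D by (simp add: pieces_def)

lemma closed_piece: "K \<in> pieces d \<Longrightarrow> closed K"
  using edge_closed by (auto simp: pieces_def)

lemma Union_pieces:
  assumes "d \<in> D"
  shows "\<Union>(pieces d) = X - inner d"
proof
  show "\<Union>(pieces d) \<subseteq> X - inner d"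
    using ends_not_inner[OF assms] inner_avoids_edge[OF assms] edge_subset
      path_image_inner[of d] assms unfolding pieces_def by blast
  have "path_image (reversepath d) = path_image d" by simp
  then have "x \<in> \<Union>(pieces d)" if "x \<in> X - inner d" for x
    using that union path_image_inner[of d] unfolding pieces_def by auto
  then show "X - inner d \<subseteq> \<Union>(pieces d)" by blast
qed

text \<open>Otherwise an arc outside the open edge would close it up to a circle.\<close>

lemma ends_separated:
  assumes "d \<in> D"
  shows "pathfinish d \<notin> side d"
proof
  assume fin: "pathfinish d \<in> side d"
  let ?Y = "X - inner d"
  have joined: "arc_joined K x y" if "K \<in> pieces d" "x \<in> K" "y \<in> K" for K x y
    using that arcs arc_joined_arc unfolding pieces_def
    by (auto simp: arc_joined_def[of "{_}"])
  have Y: "pathstart d \<in> ?Y" using assms edge_subset ends_not_inner by (meson DiffI pathstart_in_path_image subsetD)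
  have "arc_joined ?Y (pathstart d) (pathfinish d)"
  proof (rule arc_joined_in_finite_union[OF finite_pieces closed_piece joined])
    show "?Y = \<Union>(pieces d)" using Union_pieces assms by simp
    show "connected (side d)" "side d \<subseteq> ?Y"
      by (simp_all add: side_def connected_component_subset)
    show "pathstart d \<in> side d" using Y by (simp add: side_def)
  qed (use fin in auto)
  then obtain p where p: "arc p" "path_image p \<subseteq> ?Y" "pathstart p = pathstart d"
    "pathfinish p = pathfinish d"
    using ends_not_inner(1)[OF assms] unfolding arc_joined_def by blast
  have "simple_path (d +++ reversepath p)"
    using p arcs[OF assms] path_image_inner[of d]
    by (intro simple_path_join_loop) (auto simp: arc_reversepath)
  then have "path_image (d +++ reversepath p) homeomorphic sphere (0::complex) 1"
    using p by (intro homeomorphic_simple_path_image_circle) auto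
  moreover have "path_image (d +++ reversepath p) \<subseteq> X"
    using p edge_subset[OF assms] path_image_join_subset[of d "reversepath p"] by auto
  ultimately show False using no_circle by (auto simp: simple_closed_curve_def)
qed

lemma start_in_side: "d \<in> D \<Longrightarrow> pathstart d \<in> side d"
  unfolding side_def using edge_subset[of d] ends_not_inner[of d] pathstart_in_path_image[of d]
  by (simp add: subset_iff)

lemma side_subset: "side d \<subseteq> X - inner d"
  by (simp add: side_def connected_component_subset)

lemma side_connected: "connected (side d)"
  by (simp add: side_def)

lemma side_maximal:
  assumes "connected C" "C \<subseteq> X - inner d" "C \<inter> side d \<noteq> {}"
  shows "C \<subseteq> side d"
proof -
  obtain x where x: "x \<in> C" "x \<in> side d" using assms by blast
  then have "connected_component_set (X - inner d) x = side d"
    unfolding side_def using connected_component_eq by fast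
  then show ?thesis using connected_component_maximal[OF x(1) assms(1,2)] by simp
qed

lemma side_closed:
  assumes "d \<in> D"
  shows "closed (side d)"
proof -
  have "closed (X - inner d)"
    unfolding Union_pieces[OF assms, symmetric] using finite_pieces closed_piece by auto
  then show ?thesis
    unfolding side_def using closedin_connected_component closedin_closed_trans by blast
qed

lemma sides_disjoint:
  assumes "d \<in> D"
  shows "side d \<inter> side (reversepath d) = {}"
proof (rule ccontr)
  assume "\<not> ?thesis"
  then have "side (reversepath d) \<subseteq> side d"
    using side_maximal[of "side (reversepath d)" d] side_subset[of "reversepath d"] side_connected
    by auto
  then show False using start_in_side[OF rev[OF assms]] ends_separated[OF assms] by auto
qed

lemma edge_in_side:
  assumes "d \<in> D" "e \<in> D" "e \<noteq> d" "e \<noteq> reversepath d" "path_image e \<inter> side d \<noteq> {}"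
  shows "path_image e \<subseteq> side d"
  using assms inner_avoids_edge[OF assms(1-4)] edge_subset
  by (intro side_maximal edge_connected) auto

text \<open>An edge that meets \<open>path_image d\<close> or one of the two sides is contained in their union, so the
  other edges would form a closed set disjoint from it.\<close>

lemma sides_cover:
  assumes "d \<in> D"
  shows "X = side d \<union> inner d \<union> side (reversepath d)" (is "X = ?S")
proof
  show "X \<subseteq> ?S"
  proof (rule connected_subset_saturated[OF _ _ conn])
    show "finite (path_image ` D)" "X \<subseteq> \<Union>(path_image ` D)"
      using finite_D union by auto
    show "closed K" if "K \<in> path_image ` D" for K using that edge_closed by auto
    have d: "path_image d \<subseteq> ?S"
      using start_in_side[OF assms] start_in_side[OF rev[OF assms]] path_image_inner[of d] by auto
    then show "X \<inter> ?S \<noteq> {}" using edge_subset[OF assms] path_image_nonempty[of d] by blast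
    fix K assume K: "K \<in> path_image ` D" "K \<inter> ?S \<noteq> {}"
    then obtain e where e: "e \<in> D" "K = path_image e" by blast
    show "K \<subseteq> ?S"
    proof (cases "e = d \<or> e = reversepath d")
      case True
      then show ?thesis using d e by auto
    next
      case False
      then have "path_image e \<inter> (side d \<union> side (reversepath d)) \<noteq> {}"
        using K e inner_avoids_edge[OF assms e(1)] by blast
      then show ?thesis
        using False e edge_in_side[of d e] edge_in_side[of "reversepath d" e] assms rev
        by (metis Un_iff disjoint_iff le_supI1 le_supI2 reversepath_reversepath)
    qed
  qed
  show "?S \<subseteq> X" using side_subset inner_subset[OF assms] by blast
qed

lemma Compl_side:
  assumes "d \<in> D"
  shows "X - side d = inner d \<union> side (reversepath d)"
  using sides_cover[OF assms] sides_disjoint[OF assms] side_subset[of d] by blast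

lemma edge_at_start_in_side:
  assumes "d \<in> D" "e \<in> D" "d \<noteq> e" "pathstart d = pathstart e"
  shows "path_image e \<subseteq> side d"
proof (rule edge_in_side[OF assms(1,2)])
  show "e \<noteq> reversepath d" using assms ends_not_inner(1)[of d] by auto
  have "pathstart d \<in> path_image e \<inter> side d"
    using start_in_side[OF assms(1)] assms(4) by (metis IntI pathstart_in_path_image)
  then show "path_image e \<inter> side d \<noteq> {}" by blast
qed (use assms in auto)

text \<open>The edge \<open>e\<close> and everything ahead of it form a connected set that avoids the open edge \<open>d\<close>. Hence
  the branches seen from a vertex along distinct edges are disjoint.\<close>

lemma far_part_in_side:
  assumes "d \<in> D" "e \<in> D" "d \<noteq> e" "pathstart d = pathstart e"
  shows "X - side e \<subseteq> side d"
proof -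
  let ?C = "path_image e \<union> side (reversepath e)"
  have "pathfinish e \<in> path_image e \<inter> side (reversepath e)"
    using start_in_side[OF rev[OF assms(2)]] by auto
  then have "connected ?C"
    using edge_connected[OF assms(2)] side_connected by (intro connected_Un) auto
  moreover have "?C \<subseteq> X - inner d"
  proof -
    have "inner d \<subseteq> side e"
      using edge_at_start_in_side[of e d] assms path_image_inner[of d] by auto
    then have "side (reversepath e) \<inter> inner d = {}" using sides_disjoint[OF assms(2)] by blast
    moreover have "path_image e \<inter> inner d = {}"
      using edge_at_start_in_side[OF assms] side_subset[of d] by blast
    ultimately show ?thesis
      using edge_subset[OF assms(2)] side_subset[of "reversepath e"] by blast
  qed
  moreover have "?C \<inter> side d \<noteq> {}"
    using edge_at_start_in_side[OF assms] path_image_nonempty[of e] by blast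
  ultimately have "?C \<subseteq> side d" by (rule side_maximal)
  then show ?thesis using Compl_side[OF assms(2)] path_image_inner[of e] by blast
qed

lemma vertex_in_edge:
  assumes "p \<in> vertices" "e \<in> D" "p \<in> path_image e"
  shows "p = pathstart e \<or> p = pathfinish e"
proof -
  obtain d where d: "d \<in> D" "p = pathstart d" using assms by (auto simp: vertices_def)
  show ?thesis
  proof (cases "d = e \<or> d = reversepath e")
    case False
    then have "path_image d \<inter> inner e = {}" using inner_avoids_edge[OF assms(2) d(1)] by blast
    then show ?thesis using d assms path_image_inner[of e] by auto
  qed (use d in auto)
qed

text \<open>Every point other than the vertex \<open>p\<close> is seen from \<open>p\<close> along some edge: the points that are,
  together with \<open>p\<close>, again form a union of edges.\<close>

lemma vertex_cover:
  assumes "p \<in> vertices" "x \<in> X" "x \<noteq> p"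
  shows "\<exists>d\<in>D. pathstart d = p \<and> x \<notin> side d"
proof -
  define S where "S = insert p (\<Union>d\<in>{d\<in>D. pathstart d = p}. X - side d)"
  have "X \<subseteq> S"
  proof (rule connected_subset_saturated[OF _ _ conn])
    show "finite (path_image ` D)" "X \<subseteq> \<Union>(path_image ` D)"
      using finite_D union by auto
    show "closed K" if "K \<in> path_image ` D" for K using that edge_closed by auto
    have "p \<in> X" using assms edge_subset by (auto simp: vertices_def)
    then show "X \<inter> S \<noteq> {}" by (auto simp: S_def)
    have at: "path_image d \<subseteq> S" if "d \<in> D" "pathstart d = p" for d
    proof -
      have "pathfinish d \<notin> side d" "inner d \<inter> side d = {}"
        using ends_separated side_subset[of d] that by auto
      then show ?thesis using that path_image_inner[of d] edge_subset[of d] by (auto simp: S_def)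
    qed
    fix K assume K: "K \<in> path_image ` D" "K \<inter> S \<noteq> {}"
    then obtain e where e: "e \<in> D" "K = path_image e" by blast
    show "K \<subseteq> S"
    proof (cases "pathstart e = p \<or> pathfinish e = p")
      case True
      then show ?thesis using at[of e] at[of "reversepath e"] e rev by auto
    next
      case False
      then have "p \<notin> path_image e" using vertex_in_edge assms e by blast
      then obtain d y where d: "d \<in> D" "pathstart d = p" "y \<in> path_image e" "y \<notin> side d"
        using K e by (auto simp: S_def)
      have "e \<noteq> d" "e \<noteq> reversepath d" using False d by auto
      then have "path_image e \<inter> side d = {}" using edge_in_side[OF d(1) e(1)] d by blast
      then show ?thesis using e d edge_subset[OF e(1)] by (auto simp: S_def)
    qed
  qed
  then show ?thesis using assms by (auto simp: S_def)
qed

section \<open>Orders of the points of a tree\<close>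

definition out_edges :: "'a \<Rightarrow> (real \<Rightarrow> 'a) set" where
  "out_edges p = {d \<in> D. pathstart d = p}"

lemma side_Int_edge:
  assumes "d \<in> D"
  shows "side d \<inter> path_image d = {pathstart d}"
  using ends_separated[OF assms] start_in_side[OF assms] side_subset[of d] path_image_inner[of d]
  by auto

lemma half_open_image: "d ` {0..<1} = insert (pathstart d) (inner d)"
proof -
  have "{0..<1::real} = insert 0 {0<..<1}" by auto
  then show ?thesis by (simp add: inner_def pathstart_def)
qed

lemma open_inner:
  assumes "d \<in> D"
  shows "openin (top_of_set X) (inner d)"
proof -
  have "closed (X - inner d)"
    unfolding Union_pieces[OF assms, symmetric] using finite_pieces closed_piece by auto
  then have "openin (top_of_set X) (X \<inter> - (X - inner d))" by (intro openin_open_Int open_Compl)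
  moreover have "X \<inter> - (X - inner d) = inner d" using inner_subset[OF assms] by blast
  ultimately show ?thesis by simp
qed

text \<open>The edges at \<open>p\<close> without their far ends form an open set, as its complement consists of the far
  ends and of the edges that avoid \<open>p\<close>.\<close>

lemma star_out_edges:
  assumes "p \<in> vertices"
  shows "star X p (out_edges p)"
proof -
  have disj: "path_image d \<inter> path_image e = {p}" if "d \<in> out_edges p" "e \<in> out_edges p" "d \<noteq> e" for d e
    using that edge_at_start_in_side[of d e] side_Int_edge[of d] pathstart_in_path_image[of e]
    unfolding out_edges_def by auto
  let ?F = "\<Union>(path_image ` {e \<in> D. p \<notin> path_image e}) \<union> pathfinish ` out_edges p"
  have fin: "finite (out_edges p)" using finite_D by (simp add: out_edges_def)
  have "closed ?F"
    using finite_D fin edge_closed by (intro closed_Un closed_UN) (auto intro: finite_imp_closed)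
  then have "openin (top_of_set X) (X \<inter> - ?F)" by (intro openin_open_Int open_Compl)
  moreover have "X \<inter> - ?F = (\<Union>d\<in>out_edges p. d ` {0..<1})"
  proof
    show "X \<inter> - ?F \<subseteq> (\<Union>d\<in>out_edges p. d ` {0..<1})"
    proof
      fix x assume x: "x \<in> X \<inter> - ?F"
      then obtain e where e: "e \<in> D" "x \<in> path_image e" using union by blast
      then have "p \<in> path_image e" using x by blast
      then have "p = pathstart e \<or> p = pathfinish e" using vertex_in_edge assms e by blast
      then obtain d where d: "d \<in> out_edges p" "path_image d = path_image e"
        using e rev[of e] by (metis (mono_tags, lifting) mem_Collect_eq out_edges_def
            path_image_reversepath pathstart_reversepath)
      then have "x \<noteq> pathfinish d" using x by blast
      then have "x \<in> d ` {0..<1}" using d e path_image_inner[of d] half_open_image[of d] by auto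
      then show "x \<in> (\<Union>d\<in>out_edges p. d ` {0..<1})" using d by (intro UN_I)
    qed
    show "(\<Union>d\<in>out_edges p. d ` {0..<1}) \<subseteq> X \<inter> - ?F"
    proof
      fix x assume "x \<in> (\<Union>d\<in>out_edges p. d ` {0..<1})"
      then obtain d where d: "d \<in> D" "pathstart d = p" "x = p \<or> x \<in> inner d"
        unfolding out_edges_def half_open_image by (metis (mono_tags, lifting) UN_E insertE mem_Collect_eq)
      have "x \<in> X" using d edge_subset[of d] path_image_inner[of d] by auto
      moreover have "x \<notin> path_image e" if "e \<in> D" "p \<notin> path_image e" for e
      proof -
        have "e \<noteq> d" "e \<noteq> reversepath d" using that d by auto
        then show ?thesis using inner_avoids_edge[OF d(1) that(1)] d that by blast
      qed
      moreover have "x \<noteq> pathfinish e" if "e \<in> out_edges p" for e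
      proof (cases "e = d")
        case True
        then show ?thesis using d ends_not_inner[OF d(1)] by auto
      next
        case False
        then have "path_image d \<inter> path_image e = {p}"
          using disj[of d e] d that by (auto simp: out_edges_def)
        moreover have "pathfinish e \<noteq> p" "pathfinish e \<in> path_image e"
          using that ends_not_inner(1)[of e] by (auto simp: out_edges_def)
        moreover have "x \<in> path_image d" using d path_image_inner[of d] by auto
        ultimately show ?thesis by blast
      qed
      ultimately show "x \<in> X \<inter> - ?F" by blast
    qed
  qed
  moreover have "out_edges p \<noteq> {}" using assms by (auto simp: out_edges_def vertices_def)
  ultimately show ?thesis
    unfolding star_def using fin disj arcs edge_subset by (auto simp: out_edges_def)
qed

lemma reversepath_image: "reversepath d ` {1 - t..1} = d ` {0..t}"
proof -
  have "(\<lambda>x::real. 1 - x) ` {1 - t..1} = {0..t}"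
    by (auto intro!: image_eqI[of _ _ "1 - _"])
  then show ?thesis unfolding reversepath_def by (metis image_image)
qed

lemma reversepath_image_open: "reversepath d ` {1 - t..<1} = d ` {0<..t}"
proof -
  have "(\<lambda>x::real. 1 - x) ` {1 - t..<1} = {0<..t}"
    by (auto intro!: image_eqI[of _ _ "1 - _"])
  then show ?thesis unfolding reversepath_def by (metis image_image)
qed

lemma point_order_inner:
  assumes "d \<in> D" "0 < t" "t < 1"
  shows "point_order X (d t) = 2"
proof -
  let ?a = "subarc t 1 d" and ?b = "subarc (1 - t) 1 (reversepath d)"
  have d: "arc d" using assms arcs by simp
  note inj = arc_image_eq_iff[OF d]
  have a: "arc ?a" "path_image ?a = d ` {t..1}" "?a ` {0..<1} = d ` {t..<1}"
    using assms d by (auto simp: subarc_image subarc_image_open intro!: arc_subarc)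
  have b: "arc ?b" "path_image ?b = d ` {0..t}" "?b ` {0..<1} = d ` {0<..t}"
    using assms d by (auto simp: subarc_image subarc_image_open reversepath_image
        reversepath_image_open arc_reversepath intro!: arc_subarc)
  have Int: "path_image ?a \<inter> path_image ?b = {d t}"
    unfolding a b using assms inj by auto
  have "pathfinish ?a \<noteq> pathfinish ?b"
    using inj[of 1 0] by (simp add: reversepath_def)
  then have "?a \<noteq> ?b" by metis
  then have "card {?a, ?b} = 2" by simp
  moreover have "star X (d t) {?a, ?b}"
    unfolding star_def
  proof (intro conjI ballI impI)
    fix e assume e: "e \<in> {?a, ?b}"
    show "arc e" using e a b by auto
    show "pathstart e = d t" using e by (auto simp: reversepath_def)
    have "d ` {t..1} \<subseteq> path_image d" "d ` {0..t} \<subseteq> path_image d"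
      unfolding path_image_def using assms by auto
    then have "d ` {t..1} \<subseteq> X" "d ` {0..t} \<subseteq> X" using edge_subset[OF assms(1)] by (meson order_trans)+
    then show "path_image e \<subseteq> X" using e a(2) b(2) by (metis empty_iff insertE)
  next
    fix e f assume "e \<in> {?a, ?b}" "f \<in> {?a, ?b}" "e \<noteq> f"
    then show "path_image e \<inter> path_image f = {d t}" using Int by (auto simp: Int_commute)
  next
    have "{t..<1} \<union> {0<..t} = {0<..<1}" using assms by auto
    then have "d ` {t..<1} \<union> d ` {0<..t} = inner d" unfolding inner_def by (metis image_Un)
    then show "openin (top_of_set X) (\<Union>e\<in>{?a, ?b}. e ` {0..<1})"
      using a b open_inner[OF assms(1)] by simp
  qed auto
  ultimately show ?thesis using point_order_star[of X "d t" "{?a, ?b}"] by (simp add: numeral_eq_enat)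
qed

lemma point_order_vertex: "p \<in> vertices \<Longrightarrow> point_order X p = enat (card (out_edges p))"
  using point_order_star star_out_edges by blast

lemma vertices_subset: "vertices \<subseteq> X"
  using edge_subset by (auto simp: vertices_def)

lemma pathfinish_vertices: "d \<in> D \<Longrightarrow> pathfinish d \<in> vertices"
  using rev[of d] by (metis imageI pathstart_reversepath vertices_def)

lemma not_vertex_inner:
  assumes "p \<in> X" "p \<notin> vertices"
  obtains d t where "d \<in> D" "0 < t" "t < 1" "p = d t"
proof -
  obtain d where d: "d \<in> D" "p \<in> path_image d" using assms union by blast
  then have "p \<in> inner d"
    using path_image_inner[of d] assms pathfinish_vertices[of d] by (auto simp: vertices_def)
  then show ?thesis using that d by (auto simp: inner_def)
qed

text \<open>Points that are not vertices have order 2, so the orders of interest are the degrees of vertices.\<close>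

lemma endpoints_eq: "endpoints X = {p \<in> vertices. card (out_edges p) = 1}"
proof -
  have "point_order X p = 1 \<longleftrightarrow> p \<in> vertices \<and> card (out_edges p) = 1" if "p \<in> X" for p
  proof (cases "p \<in> vertices")
    case True
    then show ?thesis by (simp add: point_order_vertex one_enat_def)
  next
    case False
    then have "point_order X p = 2" using point_order_inner not_vertex_inner that by metis
    then show ?thesis using False by simp
  qed
  then show ?thesis unfolding endpoints_def using vertices_subset by blast
qed

lemma ramification_points_eq: "ramification_points X = {p \<in> vertices. 3 \<le> card (out_edges p)}"
proof -
  have "3 \<le> point_order X p \<longleftrightarrow> p \<in> vertices \<and> 3 \<le> card (out_edges p)" if "p \<in> X" for p
  proof (cases "p \<in> vertices")
    case True
    then show ?thesis by (simp add: point_order_vertex numeral_eq_enat)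
  next
    case False
    then have "point_order X p = 2" using point_order_inner not_vertex_inner that by metis
    then show ?thesis using False by (simp add: numeral_eq_enat)
  qed
  then show ?thesis unfolding ramification_points_def using vertices_subset by blast
qed


section \<open>Counting edges\<close>

lemma inj_reversepath: "inj_on reversepath S"
  by (rule inj_onI) (metis reversepath_reversepath)

lemma vertex_not_inner: "p \<in> vertices \<Longrightarrow> d \<in> D \<Longrightarrow> p \<notin> inner d"
  using vertex_in_edge[of p d] ends_not_inner[of d] path_image_inner[of d] by blast

text \<open>Root the tree at a vertex \<open>r\<close>. Every other vertex has exactly one edge leading towards \<open>r\<close>,
  and every edge leads towards \<open>r\<close> in exactly one of its two directions.\<close>

lemma card_directed_edges:
  assumes "D \<noteq> {}"
  shows "card D + 2 = 2 * card vertices"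
proof -
  obtain r where r: "r \<in> vertices" using assms by (auto simp: vertices_def)
  \<comment> \<open>the edges directed towards \<open>r\<close>\<close>
  define A where "A = {d \<in> D. r \<notin> side d}"
  have finA: "finite A" using finite_D by (simp add: A_def)
  have opp: "r \<in> side (reversepath d) \<longleftrightarrow> r \<notin> side d" if "d \<in> D" for d
    using sides_cover[OF that] sides_disjoint[OF that] vertex_not_inner[OF r that] r vertices_subset
    by blast
  have "reversepath ` A = {d \<in> D. r \<in> side d}"
    using opp rev unfolding A_def by (auto intro!: image_eqI[of _ reversepath "reversepath _"])
  then have "D = A \<union> reversepath ` A" "A \<inter> reversepath ` A = {}" by (auto simp: A_def)
  then have "card D = card A + card (reversepath ` A)"
    using finA by (metis card_Un_disjoint finite_imageI)
  then have "card D = 2 * card A" using card_image[OF inj_reversepath[of A]] by simp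
  moreover have "bij_betw pathstart A (vertices - {r})"
  proof (rule bij_betw_imageI)
    show "inj_on pathstart A"
    proof (rule inj_onI, rule ccontr)
      fix d e assume de: "d \<in> A" "e \<in> A" "pathstart d = pathstart e" "d \<noteq> e"
      then have "X - side e \<subseteq> side d" using far_part_in_side by (auto simp: A_def)
      then show False using de r vertices_subset by (auto simp: A_def)
    qed
    show "pathstart ` A = vertices - {r}"
    proof
      show "pathstart ` A \<subseteq> vertices - {r}"
        using start_in_side by (auto simp: A_def vertices_def)
      show "vertices - {r} \<subseteq> pathstart ` A"
      proof
        fix p assume "p \<in> vertices - {r}"
        then obtain d where "d \<in> D" "pathstart d = p" "r \<notin> side d"
          using vertex_cover[of p r] r vertices_subset by blast
        then show "p \<in> pathstart ` A" by (auto simp: A_def)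
      qed
    qed
  qed
  then have "card A = card (vertices - {r})" by (rule bij_betw_same_card)
  moreover have "card vertices > 0" using r finite_D by (auto simp: card_gt_0_iff vertices_def)
  ultimately show ?thesis using r by simp
qed

lemma handshake: "card D = (\<Sum>p\<in>vertices. card (out_edges p))"
proof -
  have "sum (\<lambda>_. 1::nat) D = (\<Sum>p\<in>pathstart ` D. sum (\<lambda>_. 1::nat) {d \<in> D. pathstart d = p})"
    by (rule sum.image_gen) (rule finite_D)
  then show ?thesis by (simp add: vertices_def out_edges_def)
qed

lemma card_edges_to_endpoints:
  "card {d \<in> D. pathfinish d \<in> endpoints X} = card (endpoints X)"
proof (rule bij_betw_same_card[of pathfinish], rule bij_betw_imageI)
  show "inj_on pathfinish {d \<in> D. pathfinish d \<in> endpoints X}"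
  proof (rule inj_onI)
    fix d e assume d: "d \<in> {d \<in> D. pathfinish d \<in> endpoints X}"
      and e: "e \<in> {d \<in> D. pathfinish d \<in> endpoints X}" and eq: "pathfinish d = pathfinish e"
    then have "card (out_edges (pathfinish d)) = 1" by (simp add: endpoints_eq)
    moreover have "reversepath d \<in> out_edges (pathfinish d)" "reversepath e \<in> out_edges (pathfinish d)"
      using d e eq rev by (auto simp: out_edges_def)
    ultimately have "reversepath d = reversepath e" by (metis card_1_singletonE singletonD)
    then show "d = e" by (metis reversepath_reversepath)
  qed
  show "pathfinish ` {d \<in> D. pathfinish d \<in> endpoints X} = endpoints X"
  proof
    show "endpoints X \<subseteq> pathfinish ` {d \<in> D. pathfinish d \<in> endpoints X}"
    proof
      fix p assume p: "p \<in> endpoints X"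
      then obtain d where "d \<in> D" "pathstart d = p" by (auto simp: endpoints_eq vertices_def)
      then show "p \<in> pathfinish ` {d \<in> D. pathfinish d \<in> endpoints X}"
        using p rev[of d] by (intro image_eqI[of _ _ "reversepath d"]) auto
    qed
  qed auto
qed

section \<open>Subcontinua with connected complement\<close>

text \<open>The part of the tree that is not beyond the point \<open>d t\<close> in the direction of \<open>d\<close>.\<close>

definition upto :: "(real \<Rightarrow> 'a) \<Rightarrow> real \<Rightarrow> 'a set" where
  "upto d t = side d \<union> d ` {0..t}"

lemma upto_0: "d \<in> D \<Longrightarrow> upto d 0 = side d"
  using start_in_side[of d] by (auto simp: upto_def pathstart_def)

lemma upto_mono: "s \<le> t \<Longrightarrow> upto d s \<subseteq> upto d t"
  by (auto simp: upto_def)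

lemma upto_reversepath: "upto (reversepath d) (1 - t) = side (reversepath d) \<union> d ` {t..1}"
proof -
  have "reversepath d ` {0..1 - t} = d ` {t..1}"
    using reversepath_image[of "reversepath d" "1 - t"] by simp
  then show ?thesis by (simp add: upto_def)
qed

lemma segment_subset: "0 \<le> s \<Longrightarrow> t \<le> 1 \<Longrightarrow> d ` {s..t} \<subseteq> path_image d"
  by (auto simp: path_image_def)

lemma edge_inj:
  "d \<in> D \<Longrightarrow> s \<in> {0..1} \<Longrightarrow> t \<in> {0..1} \<Longrightarrow> d s = d t \<longleftrightarrow> s = t"
  using arc_image_eq_iff arcs by blast

lemma upto_Un_opposite:
  assumes "d \<in> D" "0 \<le> t" "t \<le> 1"
  shows "upto d t \<union> upto (reversepath d) (1 - t) = X"
proof -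
  have "{0..t} \<union> {t..1} = {0..1}" using assms by auto
  then have "d ` {0..t} \<union> d ` {t..1} = path_image d" unfolding path_image_def by (metis image_Un)
  then have "upto d t \<union> upto (reversepath d) (1 - t) = side d \<union> side (reversepath d) \<union> path_image d"
    unfolding upto_reversepath upto_def[of d] by blast
  then show ?thesis
    using sides_cover[OF assms(1)] edge_subset[OF assms(1)] path_image_inner[of d] by blast
qed

lemma upto_Int_opposite:
  assumes "d \<in> D" "0 \<le> t" "t \<le> 1"
  shows "upto d t \<inter> upto (reversepath d) (1 - t) = {d t}"
proof
  have ends: "side d \<inter> path_image d = {d 0}" "side (reversepath d) \<inter> path_image d = {d 1}"
    using side_Int_edge[OF assms(1)] side_Int_edge[OF rev[OF assms(1)]]
    unfolding pathstart_reversepath path_image_reversepath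
    by (simp_all add: pathstart_def pathfinish_def)
  have edge: "d ` {0..t} \<subseteq> path_image d" "d ` {t..1} \<subseteq> path_image d"
    using assms by (simp_all add: segment_subset)
  have first: "t = 0" if "d 0 \<in> d ` {t..1}"
  proof -
    from that obtain s where "d 0 = d s" "s \<in> {t..1}" by (rule imageE)
    then show ?thesis using edge_inj[OF assms(1), of 0 s] assms by auto
  qed
  have last: "t = 1" if "d 1 \<in> d ` {0..t}"
  proof -
    from that obtain s where "d 1 = d s" "s \<in> {0..t}" by (rule imageE)
    then show ?thesis using edge_inj[OF assms(1), of 1 s] assms by auto
  qed
  have common: "d ` {0..t} \<inter> d ` {t..1} \<subseteq> {d t}"
  proof
    fix x assume "x \<in> d ` {0..t} \<inter> d ` {t..1}"
    then obtain u s where "0 \<le> u" "u \<le> t" "x = d u" "t \<le> s" "s \<le> 1" "x = d s" by auto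
    then show "x \<in> {d t}" using edge_inj[OF assms(1), of u s] assms by auto
  qed
  show "upto d t \<inter> upto (reversepath d) (1 - t) \<subseteq> {d t}"
  proof
    fix x assume "x \<in> upto d t \<inter> upto (reversepath d) (1 - t)"
    then have "x \<in> side d \<or> x \<in> d ` {0..t}" "x \<in> side (reversepath d) \<or> x \<in> d ` {t..1}"
      unfolding upto_reversepath upto_def[of d] by simp_all
    then consider "x \<in> side d \<inter> side (reversepath d)" | "x \<in> side d" "x \<in> d ` {t..1}"
      | "x \<in> side (reversepath d)" "x \<in> d ` {0..t}" | "x \<in> d ` {0..t}" "x \<in> d ` {t..1}"
      by fast
    then show "x \<in> {d t}"
    proof cases
      case 2
      then have x: "x = d 0" using ends(1) subsetD[OF edge(2)] by (metis IntI singletonD)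
      then have "t = 0" using 2(2) by (intro first) simp
      then show ?thesis using x by simp
    next
      case 3
      then have x: "x = d 1" using ends(2) subsetD[OF edge(1)] by (metis IntI singletonD)
      then have "t = 1" using 3(2) by (intro last) simp
      then show ?thesis using x by simp
    next
      case 1
      then show ?thesis using sides_disjoint[OF assms(1)] by simp
    next
      case 4
      then show ?thesis by (intro subsetD[OF common] IntI)
    qed
  qed
  show "{d t} \<subseteq> upto d t \<inter> upto (reversepath d) (1 - t)"
    using assms unfolding upto_reversepath upto_def[of d] by simp
qed

lemma upto_closed:
  assumes "d \<in> D" "t \<le> 1"
  shows "closed (upto d t)"
  unfolding upto_def using assms arcs
  by (intro closed_Un side_closed compact_imp_closed arc_compact_segment) auto

lemma upto_connected:
  assumes "d \<in> D" "0 \<le> t" "t \<le> 1"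
  shows "connected (upto d t)"
proof -
  have "pathstart d \<in> side d \<inter> d ` {0..t}"
    using start_in_side assms by (auto simp: pathstart_def)
  then show ?thesis
    unfolding upto_def using side_connected arcs assms
    by (intro connected_Un arc_connected_image) (auto simp: is_interval_cc)
qed

lemma upto_subset: "d \<in> D \<Longrightarrow> 0 \<le> t \<Longrightarrow> t \<le> 1 \<Longrightarrow> upto d t \<subseteq> X"
  using upto_Un_opposite by blast

lemma upto_nonempty: "d \<in> D \<Longrightarrow> upto d t \<noteq> {}"
  using start_in_side by (auto simp: upto_def)

lemma upto_hyper_C:
  assumes "d \<in> D" "0 \<le> t" "t \<le> 1"
  shows "upto d t \<in> hyper_C X"
  using assms upto_closed upto_connected upto_subset upto_nonempty
  by (auto simp: hyper_C_def subcontinuum_def closed_subset)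

lemma Compl_upto:
  assumes "d \<in> D" "0 \<le> t" "t < 1"
  shows "X - upto d t = side (reversepath d) \<union> d ` {t<..1}"
proof -
  have "{t..1} = insert t {t<..1}" using assms by auto
  then have "d ` {t..1} = insert (d t) (d ` {t<..1})" by (metis image_insert)
  then have "upto (reversepath d) (1 - t) = insert (d t) (side (reversepath d) \<union> d ` {t<..1})"
    by (simp add: upto_reversepath)
  moreover have "d t \<notin> side (reversepath d) \<union> d ` {t<..1}"
  proof -
    have "side (reversepath d) \<inter> path_image d = {d 1}"
      using side_Int_edge[OF rev[OF assms(1)]] by (simp add: pathfinish_def)
    moreover have "d t \<in> path_image d" using assms by (auto simp: path_image_def)
    moreover have "d t \<noteq> d s" if "s \<in> {t<..1}" for s
      using that assms edge_inj[of d t s] by auto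
    ultimately show ?thesis using assms by force
  qed
  moreover have "upto d t \<union> upto (reversepath d) (1 - t) = X"
    "upto d t \<inter> upto (reversepath d) (1 - t) = {d t}"
    using upto_Un_opposite[OF assms(1), of t] upto_Int_opposite[OF assms(1), of t] assms by simp_all
  moreover have "Z - U = W" if "R = insert z W" "z \<notin> W" "U \<union> R = Z" "U \<inter> R = {z}"
    for z and U R W Z :: "'a set"
    using that unfolding set_eq_iff Un_iff Int_iff insert_iff Diff_iff by (metis empty_iff)
  ultimately show ?thesis by metis
qed

lemma upto_neq_X: "d \<in> D \<Longrightarrow> 0 \<le> t \<Longrightarrow> t < 1 \<Longrightarrow> upto d t \<noteq> X"
  using Compl_upto[of d t] by force

lemma upto_NC_star:
  assumes "d \<in> D" "0 \<le> t" "t < 1"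
  shows "upto d t \<in> NC_star X"
proof -
  have "pathfinish d \<in> side (reversepath d) \<inter> d ` {t<..1}"
    using start_in_side[OF rev[OF assms(1)]] assms by (auto simp: pathfinish_def)
  moreover have "is_interval {t<..1}" by (simp add: is_interval_oc)
  ultimately have "connected (side (reversepath d) \<union> d ` {t<..1})"
    using side_connected arcs assms by (intro connected_Un arc_connected_image) auto
  then show ?thesis
    using Compl_upto[OF assms] upto_hyper_C[of d t] assms by (simp add: NC_star_def)
qed

lemma upto_1_endpoint:
  assumes "d \<in> D" "card (out_edges (pathfinish d)) = 1"
  shows "upto d 1 = X"
proof -
  let ?c = "reversepath d"
  have "?c \<in> out_edges (pathfinish d)" using rev assms by (simp add: out_edges_def)
  then have only: "out_edges (pathfinish d) = {?c}" using assms(2) by (metis card_1_singletonE singletonD)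
  have "side ?c \<subseteq> {pathfinish d}"
  proof (rule ccontr)
    assume "\<not> ?thesis"
    then obtain x where x: "x \<in> side ?c" "x \<noteq> pathfinish d" by blast
    then have "x \<in> X" using side_subset by blast
    then obtain e where "e \<in> D" "pathstart e = pathfinish d" "x \<notin> side e"
      using vertex_cover x pathfinish_vertices assms(1) by metis
    moreover from this have "e \<in> out_edges (pathfinish d)" by (simp add: out_edges_def)
    ultimately show False using only x by simp
  qed
  moreover have "d ` {0..1} = path_image d" by (simp add: path_image_def)
  ultimately show ?thesis
    using sides_cover[OF assms(1)] edge_subset[OF assms(1)] path_image_inner[of d] side_subset[of d]
    unfolding upto_def by auto
qed

text \<open>At a ramification point \<open>v\<close> the complement of \<open>upto d 1\<close> falls apart into the
  branches that are seen from \<open>v\<close> along the other edges at \<open>v\<close>.\<close>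

lemma upto_1_ramification:
  assumes "d \<in> D" "3 \<le> card (out_edges (pathfinish d))"
  shows "upto d 1 \<notin> NC_star X"
proof
  assume "upto d 1 \<in> NC_star X"
  \<comment> \<open>besides \<open>?c\<close>, two more edges \<open>h\<close> and \<open>k\<close> start at \<open>?v\<close>, and \<open>?v\<close> separates their far ends\<close>
  let ?c = "reversepath d" and ?v = "pathfinish d"
  have c: "?c \<in> out_edges ?v" using rev assms by (simp add: out_edges_def)
  have "finite (out_edges ?v)" using finite_D by (simp add: out_edges_def)
  then have "2 \<le> card (out_edges ?v - {?c})" using assms(2) c by simp
  then obtain h k where hk: "h \<in> out_edges ?v - {?c}" "k \<in> out_edges ?v - {?c}" "h \<noteq> k"
    using card_le_Suc0_iff_eq[of "out_edges ?v - {?c}"] \<open>finite (out_edges ?v)\<close> by fastforce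
  define Z where "Z = X - upto d 1"
  have "upto d 1 \<inter> side ?c = {?v}" "upto d 1 \<union> side ?c = X"
    using upto_Int_opposite[OF assms(1), of 1] upto_Un_opposite[OF assms(1), of 1] upto_0[of ?c]
      rev[OF assms(1)] by (simp_all add: pathfinish_def)
  then have Z: "Z = side ?c - {?v}" unfolding Z_def by blast
  have h: "h \<in> D" "k \<in> D" "pathstart h = ?v" "pathstart k = ?v" using hk by (auto simp: out_edges_def)
  let ?A = "side h" and ?B = "upto (reversepath h) 1"
  have AB: "?A \<union> ?B = X" "?A \<inter> ?B = {?v}"
    using upto_Un_opposite[OF h(1), of 0] upto_Int_opposite[OF h(1), of 0] upto_0[OF h(1)] h
    by (simp_all add: pathstart_def)
  have "?A \<inter> Z \<noteq> {}"
  proof -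
    have "pathfinish k \<in> side h" "pathfinish k \<in> side ?c"
      using edge_at_start_in_side[of h k] edge_at_start_in_side[of ?c k] h hk rev[OF assms(1)]
        pathfinish_in_path_image[of k] by auto
    then show ?thesis unfolding Z using ends_not_inner(1)[OF h(2)] h by auto
  qed
  moreover have "?B \<inter> Z \<noteq> {}"
  proof -
    have "pathfinish h \<in> side (reversepath h)" using start_in_side[OF rev[OF h(1)]] by simp
    then have "pathfinish h \<in> ?B" by (simp add: upto_def)
    moreover have "pathfinish h \<in> side ?c"
      using edge_at_start_in_side[of ?c h] h hk rev[OF assms(1)] pathfinish_in_path_image[of h] by auto
    ultimately show ?thesis unfolding Z using ends_not_inner(1)[OF h(1)] h by auto
  qed
  moreover have "closed ?A" "closed ?B"
    using side_closed[OF h(1)] upto_closed[OF rev[OF h(1)]] by auto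
  moreover have "Z \<subseteq> ?A \<union> ?B" "?A \<inter> ?B \<inter> Z = {}" using AB Z Z_def by auto
  moreover have "connected Z"
    using \<open>upto d 1 \<in> NC_star X\<close> by (simp add: NC_star_def Z_def)
  ultimately show False unfolding connected_closed by blast
qed

text \<open>\<open>upto e s\<close> contains the start of \<open>e\<close> but not its end, and the other way round for the reversal
  of \<open>e\<close>. If \<open>d\<close> is neither of the two, the whole of \<open>e\<close> lies on one side of \<open>d\<close>, so \<open>upto d t\<close>
  contains both ends of \<open>e\<close> or neither.\<close>

lemma upto_inj:
  assumes "d \<in> D" "e \<in> D" "0 \<le> t" "t < 1" "0 \<le> s" "s < 1" "upto d t = upto e s"
  shows "d = e \<and> t = s"
proof -
  have start: "pathstart e \<in> upto e s" "pathstart d \<in> upto d t"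
    using start_in_side assms by (auto simp: upto_def)
  have finish: "pathfinish e \<notin> upto e s" "pathfinish d \<notin> upto d t"
    using Compl_upto[of e s] Compl_upto[of d t] assms
      start_in_side[OF rev[OF assms(1)]] start_in_side[OF rev[OF assms(2)]] by auto
  consider "d = e" | "e = reversepath d" | "e \<noteq> d" "e \<noteq> reversepath d" by blast
  then show ?thesis
  proof cases
    case 1
    have "d s \<in> upto d s" "d t \<in> upto d t" using assms by (auto simp: upto_def)
    moreover have "d s \<notin> upto d t" if "t < s" using Compl_upto[of d t] assms that by auto
    moreover have "d t \<notin> upto d s" if "s < t" using Compl_upto[of d s] assms that by auto
    ultimately show ?thesis using assms 1 by (metis linorder_neqE_linordered_idom)
  next
    case 2
    then show ?thesis using start finish assms by auto
  next
    case 3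
    then have "path_image e \<inter> inner d = {}" using inner_avoids_edge assms by blast
    moreover have "path_image e \<subseteq> X" "path_image e \<noteq> {}" using edge_subset assms by auto
    ultimately have "path_image e \<inter> side d \<noteq> {} \<or> path_image e \<inter> side (reversepath d) \<noteq> {}"
      using sides_cover[OF assms(1)] by blast
    then have "path_image e \<subseteq> side d \<or> path_image e \<subseteq> side (reversepath d)"
      using 3 edge_in_side[of d e] edge_in_side[of "reversepath d" e] assms rev by auto
    then show ?thesis
    proof
      assume "path_image e \<subseteq> side d"
      then have "pathfinish e \<in> upto d t" unfolding upto_def by auto
      then show ?thesis using finish assms by simp
    next
      assume "path_image e \<subseteq> side (reversepath d)"
      then have "pathstart e \<in> X - upto d t" using Compl_upto[of d t] assms by auto
      then show ?thesis using start assms by simp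
    qed
  qed
qed

text \<open>Each point \<open>x\<close> different from \<open>p\<close> lies beyond \<open>p\<close> in one of the directions at \<open>p\<close>; this covers
  vertices and inner points of edges alike.\<close>

lemma point_cover:
  assumes "p \<in> X" "x \<in> X" "x \<noteq> p"
  obtains d t where "d \<in> D" "0 \<le> t" "t < 1" "d t = p" "x \<notin> upto d t"
proof (cases "p \<in> vertices")
  case True
  then obtain d where "d \<in> D" "pathstart d = p" "x \<notin> side d" using vertex_cover assms by blast
  then show ?thesis using that[of d 0] upto_0[of d] by (simp add: pathstart_def)
next
  case False
  then obtain d t where d: "d \<in> D" "0 < t" "t < 1" "p = d t" using not_vertex_inner assms by metis
  then have "x \<notin> upto d t \<or> x \<notin> upto (reversepath d) (1 - t)"
    using upto_Int_opposite[of d t] assms by auto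
  then show ?thesis
    using that[of d t] that[of "reversepath d" "1 - t"] d rev by (auto simp: reversepath_def)
qed

text \<open>The boundary of a proper subcontinuum \<open>A\<close> with connected complement is a single point \<open>p = d t\<close>,
  with the complement on one side of it. If \<open>A\<close> had a point beyond \<open>p\<close> on that side, then, being
  connected, \<open>A\<close> would contain an initial piece of the edge beyond \<open>p\<close>, and \<open>p\<close> would not be a
  boundary point.\<close>

lemma NC_star_cases:
  assumes "A \<in> NC_star X" "A \<noteq> X"
  obtains d t where "d \<in> D" "0 \<le> t" "t < 1" "A = upto d t"
proof -
  have XC: "closed X"
    unfolding union using finite_D edge_closed by auto
  have A: "A \<noteq> {}" "A \<subseteq> X" "closed A" "connected A" "connected (X - A)"
    using assms XC by (auto simp: NC_star_def hyper_C_def subcontinuum_def closedin_closed_eq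
      dest: closedin_imp_subset intro: closedin_closed_trans)
  then obtain x where x: "x \<in> X - A" using assms by blast
  have "A \<inter> closure (X - A) \<inter> X \<noteq> {}"
  proof
    assume "A \<inter> closure (X - A) \<inter> X = {}"
    moreover have "X \<subseteq> A \<union> closure (X - A)" "closure (X - A) \<inter> X \<noteq> {}" "A \<inter> X \<noteq> {}"
      using closure_subset[of "X - A"] x A by blast+
    ultimately show False
      using conn \<open>closed A\<close> closed_closure[of "X - A"] unfolding connected_closed by blast
  qed
  then obtain p where p: "p \<in> A" "p \<in> closure (X - A)" by blast
  then obtain d t where d: "d \<in> D" "0 \<le> t" "t < 1" "d t = p" "x \<notin> upto d t"
    using point_cover[of p x] x A by blast
  \<comment> \<open>a connected set that avoids \<open>d s\<close> stays on one side of it\<close>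
  have split: "C \<subseteq> upto d s \<or> C \<subseteq> upto (reversepath d) (1 - s)"
    if "connected C" "C \<subseteq> X" "0 \<le> s" "s < 1" "d s \<notin> C" for C s
  proof -
    have "closed (upto d s)" "closed (upto (reversepath d) (1 - s))"
      using upto_closed d rev that by auto
    moreover have "C \<subseteq> upto d s \<union> upto (reversepath d) (1 - s)"
      "upto d s \<inter> upto (reversepath d) (1 - s) \<inter> C = {}"
      using upto_Un_opposite[OF d(1), of s] upto_Int_opposite[OF d(1), of s] that by auto
    ultimately have "upto d s \<inter> C = {} \<or> upto (reversepath d) (1 - s) \<inter> C = {}"
      using that(1) unfolding connected_closed by blast
    then show ?thesis using \<open>C \<subseteq> upto d s \<union> _\<close> by blast
  qed
  have U: "X - A \<subseteq> upto (reversepath d) (1 - t)"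
    using split[of "X - A" t] A d p x by blast
  then have sub: "upto d t \<subseteq> A"
  proof -
    have "upto d t \<inter> upto (reversepath d) (1 - t) = {d t}" "upto d t \<subseteq> X"
      using upto_Int_opposite[OF d(1), of t] upto_subset[OF d(1), of t] d by auto
    then have "y = p" if "y \<in> upto d t" "y \<notin> A" for y
      using U that d(4) by (metis DiffI IntI singletonD subsetD)
    then show ?thesis using \<open>p \<in> A\<close> by auto
  qed
  have "A \<subseteq> upto d t"
  proof
    fix q assume q: "q \<in> A"
    show "q \<in> upto d t"
    proof (rule ccontr)
      assume qt: "q \<notin> upto d t"
      then have "q \<in> side (reversepath d) \<union> d ` {t<..1}" using Compl_upto[of d t] d q A by blast
      then obtain s0 where s0: "t < s0" "s0 < 1" "q \<notin> upto d s0"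
      proof
        assume q: "q \<in> side (reversepath d)"
        show ?thesis using that[of "(t + 1) / 2"] Compl_upto[of d "(t + 1) / 2"] d q by auto
      next
        assume "q \<in> d ` {t<..1}"
        then obtain u where u: "t < u" "u \<le> 1" "q = d u" by auto
        then have "q \<in> d ` {(t + u) / 2<..1}" by (intro image_eqI[of _ _ u]) auto
        moreover have "X - upto d ((t + u) / 2) = side (reversepath d) \<union> d ` {(t + u) / 2<..1}"
          using d u by (intro Compl_upto) auto
        ultimately have "q \<notin> upto d ((t + u) / 2)" by blast
        then show ?thesis using that[of "(t + u) / 2"] u by auto
      qed
      \<comment> \<open>\<open>d s\<close> separates the points \<open>p\<close> and \<open>q\<close> of the connected set \<open>A\<close>\<close>
      have "d s \<in> A" if s: "t < s" "s \<le> s0" for s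
      proof (rule ccontr)
        assume "d s \<notin> A"
        then consider "A \<subseteq> upto d s" | "A \<subseteq> upto (reversepath d) (1 - s)"
          using split[of A s] s s0 d A by auto
        then show False
        proof cases
          case 1
          then show False using q s0 upto_mono[of s s0 d] s by blast
        next
          case 2
          then have "p \<in> upto d s \<inter> upto (reversepath d) (1 - s)"
            using p d s by (auto simp: upto_def)
          then have "d t = d s" using upto_Int_opposite[OF d(1), of s] s s0 d by auto
          then show False using edge_inj[OF d(1), of t s] s s0 d by auto
        qed
      qed
      moreover have "d s \<in> A" if "0 \<le> s" "s \<le> t" for s using sub that by (auto simp: upto_def)
      ultimately have "d s \<in> A" if "0 \<le> s" "s \<le> s0" for s
        using that by (cases "s \<le> t") auto
      then have "d ` {0..s0} \<subseteq> A" by auto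
      then have "upto d s0 \<subseteq> A" using sub unfolding upto_def by simp
      then have "X - A \<subseteq> upto (reversepath d) (1 - s0)"
        using upto_Un_opposite[OF d(1), of s0] s0 d by auto
      then have "closure (X - A) \<subseteq> upto (reversepath d) (1 - s0)"
        using upto_closed[OF rev[OF d(1)], of "1 - s0"] s0 d by (intro closure_minimal) auto
      then have "p \<in> upto d s0 \<inter> upto (reversepath d) (1 - s0)"
        using p d s0 by (auto simp: upto_def)
      then have "d t = d s0" using upto_Int_opposite[OF d(1), of s0] s0 d by auto
      then show False using edge_inj[OF d(1), of t s0] s0 d by auto
    qed
  qed
  then show ?thesis using that d sub by blast
qed

lemma compact_X: "compact X"
  unfolding union using finite_D arcs by (auto intro: compact_arc_image)

text \<open>The sets are nested, so their distance is bounded by the displacement along the edge.\<close>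

lemma upto_uniform:
  assumes d: "d \<in> D" and "0 \<le> s" "s \<le> t" "t \<le> 1"
    and small: "\<And>x. s \<le> x \<Longrightarrow> x \<le> t \<Longrightarrow> dist (d x) (d s) \<le> r"
  shows "hausdorff_dist (upto d s) (upto d t) \<le> r"
proof -
  have bdd: "bounded (upto d s)" "bounded (upto d t)"
    using upto_subset[OF d] compact_X assms by (meson bounded_subset compact_imp_bounded order_trans)+
  have "0 \<le> r" using small[of s] assms by auto
  have "infdist a (upto d t) \<le> r" if "a \<in> upto d s" for a
    using that upto_mono[OF assms(3)] \<open>0 \<le> r\<close> by (simp add: subset_iff)
  moreover have "infdist b (upto d s) \<le> r" if b: "b \<in> upto d t" for b
  proof (cases "b \<in> upto d s")
    case False
    then obtain x where "s < x" "x \<le> t" "b = d x" using b by (force simp: upto_def)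
    moreover have "d s \<in> upto d s" using assms by (auto simp: upto_def)
    ultimately show ?thesis using small[of x] infdist_le2 by (metis less_imp_le)
  qed (use \<open>0 \<le> r\<close> in simp)
  ultimately show ?thesis using bdd upto_nonempty[OF d] by (simp add: hausdorff_dist_le_iff)
qed

lemma upto_continuous:
  assumes d: "d \<in> D"
  shows "continuous_map (top_of_set {0..1}) (hyper_C_topology X) (upto d)"
proof -
  interpret M: Metric_space "hyper_C X" hausdorff_dist by (rule Metric_space_hyper_C[OF compact_X])
  have sym: "hausdorff_dist A B = hausdorff_dist B A" for A B :: "'a set"
    by (auto simp: hausdorff_dist_def max.commute)
  have "uniformly_continuous_on {0..1} d"
    using arcs[OF d] by (intro compact_uniformly_continuous arc_imp_continuous_on) auto
  then have unif: "\<exists>\<delta>>0. \<forall>s\<in>{0..1}. \<forall>t\<in>{0..1}. dist t s < \<delta> \<longrightarrow> dist (d t) (d s) < r"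
    if "r > 0" for r
    using that unfolding uniformly_continuous_on_def by blast
  show ?thesis
    unfolding hyper_C_topology_def M.continuous_map_to_metric
  proof (intro ballI allI impI)
    fix s r :: real assume s: "s \<in> topspace (top_of_set {0..1})" and "r > 0"
    then obtain \<delta> where \<delta>: "\<delta> > 0"
      "\<And>x y. x \<in> {0..1} \<Longrightarrow> y \<in> {0..1} \<Longrightarrow> dist y x < \<delta> \<Longrightarrow> dist (d y) (d x) < r/2"
      using unif[of "r/2"] by auto
    have close: "hausdorff_dist (upto d x) (upto d y) \<le> r/2"
      if "x \<in> {0..1}" "y \<in> {0..1}" "x \<le> y" "dist y x < \<delta>" for x y
    proof (rule upto_uniform[OF d])
      fix z assume "x \<le> z" "z \<le> y"
      then show "dist (d z) (d x) \<le> r/2"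
        using that by (intro less_imp_le \<delta>(2)) (auto simp: dist_real_def)
    qed (use that in auto)
    have "upto d t \<in> M.mball (upto d s) r" if "t \<in> {0..1} \<inter> ball s \<delta>" for t
    proof -
      have "hausdorff_dist (upto d s) (upto d t) \<le> r/2"
      proof (cases "s \<le> t")
        case True
        then show ?thesis using close[of s t] that s by (simp add: dist_commute)
      next
        case False
        then show ?thesis
          using close[of t s] that s unfolding sym[of "upto d s" "upto d t"] by simp
      qed
      then show ?thesis using \<open>r > 0\<close> upto_hyper_C[OF d] that s by (simp add: M.in_mball)
    qed
    then show "\<exists>U. openin (top_of_set {0..1}) U \<and> s \<in> U \<and> (\<forall>y\<in>U. upto d y \<in> M.mball (upto d s) r)"
      using s \<delta> by (intro exI[of _ "{0..1} \<inter> ball s \<delta>"]) (auto intro: openin_open_Int)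
  qed
qed

end

section \<open>Removing vertices of degree two\<close>

lemma finite_graph_arc_tree:
  assumes "is_tree X"
  shows "\<exists>D. arc_tree X D"
proof -
  have X: "connected X" and "finite_graph X"
    using assms by (simp_all add: is_tree_def finite_graph_def continuum_def)
  from \<open>finite_graph X\<close> have "\<exists>G. finite G \<and> (\<forall>g\<in>G. arc g) \<and> X = (\<Union>g\<in>G. path_image g) \<and>
        (\<forall>g\<in>G. \<forall>h\<in>G. g \<noteq> h \<longrightarrow>
           path_image g \<inter> path_image h \<subseteq>
             {pathstart g, pathfinish g} \<inter> {pathstart h, pathfinish h})"
    unfolding finite_graph_def by (rule conjunct2)
  then obtain G where "finite G \<and> (\<forall>g\<in>G. arc g) \<and> X = (\<Union>g\<in>G. path_image g) \<and>
        (\<forall>g\<in>G. \<forall>h\<in>G. g \<noteq> h \<longrightarrow>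
           path_image g \<inter> path_image h \<subseteq>
             {pathstart g, pathfinish g} \<inter> {pathstart h, pathfinish h})"
    by (rule exE)
  then have G: "finite G" "\<And>g. g \<in> G \<Longrightarrow> arc g" "X = (\<Union>g\<in>G. path_image g)"
    "\<And>g h. g \<in> G \<Longrightarrow> h \<in> G \<Longrightarrow> g \<noteq> h \<Longrightarrow> path_image g \<inter> path_image h \<subseteq>
      {pathstart g, pathfinish g} \<inter> {pathstart h, pathfinish h}"
    by simp_all
  have "arc_tree X (G \<union> reversepath ` G)"
  proof
    fix d e assume de: "d \<in> G \<union> reversepath ` G" "e \<in> G \<union> reversepath ` G"
      "e \<noteq> d" "e \<noteq> reversepath d"
    obtain g where g: "g \<in> G" "d = g \<or> d = reversepath g" using de(1) by blast
    obtain h where h: "h \<in> G" "e = h \<or> e = reversepath h" using de(2) by blast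
    have "g \<noteq> h" using g h de(3,4) by auto
    moreover have "path_image d = path_image g" "{pathstart d, pathfinish d} = {pathstart g, pathfinish g}"
      "path_image e = path_image h" "{pathstart e, pathfinish e} = {pathstart h, pathfinish h}"
      using g h by auto
    ultimately show "path_image d \<inter> path_image e \<subseteq>
        {pathstart d, pathfinish d} \<inter> {pathstart e, pathfinish e}"
      using G(4)[OF g(1) h(1)] by simp
  next
    show "X = (\<Union>d\<in>G \<union> reversepath ` G. path_image d)" unfolding G(3) by simp
    show "\<not> (\<exists>S\<subseteq>X. simple_closed_curve S)" using assms by (simp add: is_tree_def)
  qed (use G X in \<open>auto simp: arc_reversepath\<close>)
  then show ?thesis ..
qed

text \<open>If \<open>a\<close> and \<open>b\<close> are the only edges at \<open>p\<close>, then \<open>p\<close> lies on no other edge, so the arc into which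
  \<open>a\<close> and \<open>b\<close> are joined meets the other edges in common ends only.\<close>

lemma (in arc_tree) merge_edges:
  assumes "card (out_edges p) = 2"
  shows "\<exists>D'. arc_tree X D' \<and> card D' < card D"
proof -
  obtain a b where ab: "out_edges p = {a, b}" "a \<noteq> b" using assms by (auto simp: card_2_iff)
  then have a: "a \<in> D" "pathstart a = p" and b: "b \<in> D" "pathstart b = p"
    unfolding out_edges_def by auto
  then have p: "p \<in> vertices" by (auto simp: vertices_def)
  have Int: "path_image a \<inter> path_image b = {p}"
    using star_out_edges[OF p] ab unfolding star_def by auto
  have neq: "b \<noteq> reversepath a" "a \<noteq> reversepath b"
    using a b ends_not_inner(1)[of a] by auto
  \<comment> \<open>both edges start at \<open>p\<close>, so one of them has to be reversed\<close>
  define k where "k = reversepath a +++ b"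
  have k: "arc k" "path_image k = path_image a \<union> path_image b"
    "pathstart k = pathfinish a" "pathfinish k = pathfinish b"
    unfolding k_def using a b Int arcs
    by (auto simp: arc_reversepath path_image_join intro!: arc_join)
  let ?O = "{a, reversepath a, b, reversepath b}"
  define D' where "D' = (D - ?O) \<union> {k, reversepath k}"
  have rev_old: "reversepath d \<in> D - ?O" if "d \<in> D - ?O" for d
    using that rev[of d] by (metis Diff_iff empty_iff insert_iff reversepath_reversepath)
  have old: "path_image d \<inter> path_image k \<subseteq> {pathstart d, pathfinish d} \<inter> {pathstart k, pathfinish k}"
    if d: "d \<in> D - ?O" for d
  proof -
    have "p \<notin> path_image d"
    proof
      assume "p \<in> path_image d"
      then have "p = pathstart d \<or> p = pathfinish d" using vertex_in_edge p d by blast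
      then have "d \<in> out_edges p \<or> reversepath d \<in> out_edges p"
        using d rev[of d] by (auto simp: out_edges_def)
      then show False using ab d rev_old[OF d] by auto
    qed
    moreover have "a \<noteq> d" "a \<noteq> reversepath d" "b \<noteq> d" "b \<noteq> reversepath d"
      using d rev_old[OF d] by auto
    ultimately show ?thesis
      using meet[of d a] meet[of d b] d a b unfolding k by auto
  qed
  have "arc_tree X D'"
  proof
    show "finite D'" using finite_D by (simp add: D'_def)
    show "connected X" "\<not> (\<exists>S\<subseteq>X. simple_closed_curve S)" by (rule conn no_circle)+
    show "arc d" if "d \<in> D'" for d using that k arcs by (auto simp: D'_def arc_reversepath)
    show "reversepath d \<in> D'" if "d \<in> D'" for d
      using that rev_old[of d] unfolding D'_def by auto
    have "(\<Union>d\<in>D'. path_image d) = (\<Union>d\<in>D - ?O. path_image d) \<union> (\<Union>d\<in>?O. path_image d)"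
      unfolding D'_def using k by auto
    also have "\<dots> = (\<Union>d\<in>D \<union> ?O. path_image d)" by blast
    also have "D \<union> ?O = D" using a b rev by auto
    finally show "X = (\<Union>d\<in>D'. path_image d)" using union by simp
    fix d e assume d: "d \<in> D'" and e: "e \<in> D'" and ne: "e \<noteq> d" "e \<noteq> reversepath d"
    consider "d \<in> D - ?O" "e \<in> D - ?O" | "d \<in> D - ?O" "e = k \<or> e = reversepath k"
      | "d = k \<or> d = reversepath k" "e \<in> D - ?O" | "d = k \<or> d = reversepath k" "e = k \<or> e = reversepath k"
      using d e unfolding D'_def by blast
    then show "path_image d \<inter> path_image e \<subseteq>
        {pathstart d, pathfinish d} \<inter> {pathstart e, pathfinish e}"
    proof cases
      case 1
      then show ?thesis using meet ne by simp
    next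
      case 2
      then show ?thesis using old[of d] by (auto simp: insert_commute)
    next
      case 3
      then show ?thesis using old[of e] by (auto simp: insert_commute)
    next
      case 4
      then show ?thesis using ne by auto
    qed
  qed
  moreover have "card D' < card D"
  proof -
    have "card ?O = 4"
    proof -
      have "reversepath a \<noteq> reversepath b" using ab(2) by (metis reversepath_reversepath)
      then show ?thesis
        using ab(2) neq reversepath_neq[OF a(1)] reversepath_neq[OF b(1)] by auto
    qed
    moreover have O: "?O \<subseteq> D" using a b rev by auto
    ultimately have "card (D - ?O) = card D - 4" "4 \<le> card D"
      using finite_D card_mono[OF finite_D O] by (simp_all add: card_Diff_subset)
    moreover have "card D' \<le> card (D - ?O) + card {k, reversepath k}"
      unfolding D'_def by (rule card_Un_le)
    moreover have "card {k, reversepath k} \<le> 2" by (simp add: card_insert_if)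
    ultimately show ?thesis by linarith
  qed
  ultimately show ?thesis by blast
qed

text \<open>Take a decomposition with the least number of edges.\<close>

lemma reduced_arc_tree_exists:
  assumes "is_tree X"
  shows "\<exists>D. arc_tree X D \<and> (\<forall>p. card (arc_tree.out_edges D p) \<noteq> 2)"
proof -
  obtain D where D: "arc_tree X D" "\<And>D'. arc_tree X D' \<Longrightarrow> card D \<le> card D'"
    using finite_graph_arc_tree[OF assms] ex_has_least_nat[of "arc_tree X" _ card] by blast
  then show ?thesis using arc_tree.merge_edges[OF D(1)] by (metis linorder_not_less)
qed


section \<open>The number of endpoints\<close>

text \<open>Vertices of degree two have order two and are thus invisible in \<open>endpoints X\<close> and
  \<open>ramification_points X\<close>; without them, these two sets make up all vertices.\<close>

locale reduced_arc_tree = arc_tree +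
  assumes no_deg2: "card (out_edges p) \<noteq> 2"
    and nonempty: "X \<noteq> {}"
begin

lemma vertex_degree:
  assumes "p \<in> vertices"
  shows "card (out_edges p) = 1 \<or> 3 \<le> card (out_edges p)"
proof -
  have "out_edges p \<noteq> {}" "finite (out_edges p)"
    using assms finite_D by (auto simp: out_edges_def vertices_def)
  then have "card (out_edges p) \<noteq> 0" by simp
  then show ?thesis using no_deg2[of p] by linarith
qed

lemma vertices_split:
  "vertices = endpoints X \<union> ramification_points X" "endpoints X \<inter> ramification_points X = {}"
  unfolding endpoints_eq ramification_points_eq using vertex_degree by fastforce+

lemma card_vertices: "card vertices = card (endpoints X) + card (ramification_points X)"
  using vertices_split finite_D by (metis card_Un_disjoint finite_Un finite_imageI vertices_def)

lemma D_nonempty: "D \<noteq> {}"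
  using nonempty union by auto

lemma card_D: "card D + 2 = 2 * (card (endpoints X) + card (ramification_points X))"
  using card_directed_edges[OF D_nonempty] card_vertices by simp

text \<open>With \<open>n\<close> endpoints and \<open>m\<close> ramification points, the sum of the degrees is \<open>2 * (n + m - 1)\<close> and at least \<open>n + 3 * m\<close>, whence \<open>n \<ge> m + 2\<close>. For
  \<open>m = 0\<close> the degree sum is \<open>n\<close>, which leaves two directed edges, that is, one arc.\<close>

lemma three_le_endpoints:
  assumes "\<not> X homeomorphic {0..1::real}"
  shows "3 \<le> card (endpoints X)"
proof -
  let ?E = "endpoints X" and ?R = "ramification_points X"
  have fin: "finite ?E" "finite ?R"
    using vertices_split(1) finite_D by (metis finite_Un finite_imageI vertices_def)+
  have "card D = (\<Sum>p\<in>?E. card (out_edges p)) + (\<Sum>p\<in>?R. card (out_edges p))"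
    unfolding handshake vertices_split(1) using fin vertices_split(2) by (rule sum.union_disjoint)
  moreover have "(\<Sum>p\<in>?E. card (out_edges p)) = (\<Sum>p\<in>?E. 1)"
    by (rule sum.cong) (auto simp: endpoints_eq)
  moreover have "(\<Sum>p\<in>?R. 3) \<le> (\<Sum>p\<in>?R. card (out_edges p))"
    by (rule sum_mono) (auto simp: ramification_points_eq)
  ultimately have le: "card ?E + 3 * card ?R \<le> card D"
    and no_ramification: "card ?R = 0 \<Longrightarrow> card D = card ?E"
    using fin by auto
  have "card D \<noteq> 2"
  proof
    assume "card D = 2"
    obtain d where d: "d \<in> D" using D_nonempty by blast
    then have "D = {d, reversepath d}"
      using \<open>card D = 2\<close> rev[OF d] reversepath_neq[OF d] finite_D
      by (intro card_seteq[symmetric]) auto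
    then have "X = path_image d" unfolding union by (metis SUP_insert Sup_empty UN_empty Un_absorb
          Un_empty_right path_image_reversepath)
    then show False using assms homeomorphic_arc_image_interval[OF arcs[OF d], of 0 1] by simp
  qed
  then show ?thesis
  proof (cases "card ?R = 0")
    case True
    then have eq: "card D = card ?E" by (rule no_ramification)
    have "card ?E + 2 = 2 * card ?E" using card_D unfolding True eq add_0_right .
    then have "card ?E = 2" by simp
    then have "card D = 2" using eq by simp
    with \<open>card D \<noteq> 2\<close> show ?thesis ..
  next
    case False
    then have "0 < card ?R" by simp
    then show ?thesis using le card_D[unfolded distrib_left] by linarith
  qed
qed


section \<open>The hyperspace as a quotient of a sum of intervals\<close>

definition to_end :: "(real \<Rightarrow> 'a) set" where
  "to_end = {d \<in> D. pathfinish d \<in> endpoints X}"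

text \<open>The parameters for which \<open>upto d t\<close> belongs to \<^term>\<open>NC_star X\<close>.\<close>

definition domain :: "(real \<Rightarrow> 'a) \<Rightarrow> real set" where
  "domain d = (if d \<in> to_end then {0..1} else {0..<1})"

lemma upto_1: "d \<in> to_end \<Longrightarrow> upto d 1 = X"
  using upto_1_endpoint by (simp add: to_end_def endpoints_eq)

lemma upto_1_not_NC_star:
  assumes "d \<in> D" "d \<notin> to_end"
  shows "upto d 1 \<notin> NC_star X"
  using assms vertex_degree[of "pathfinish d"] pathfinish_vertices[OF assms(1)]
  by (intro upto_1_ramification) (auto simp: to_end_def endpoints_eq)

lemma X_in_NC_star: "X \<in> NC_star X"
  using nonempty conn by (simp add: NC_star_def hyper_C_def subcontinuum_def)

lemma upto_in_NC_star_iff: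
  assumes "d \<in> D" "t \<in> {0..1}"
  shows "upto d t \<in> NC_star X \<longleftrightarrow> t \<in> domain d"
proof (cases "t = 1")
  case True
  then show ?thesis
    using upto_1 upto_1_not_NC_star[OF assms(1)] X_in_NC_star by (auto simp: domain_def)
next
  case False
  then show ?thesis using assms upto_NC_star[of d t] by (auto simp: domain_def)
qed

lemma domain_subset: "domain d \<subseteq> {0..1}"
  by (auto simp: domain_def)

lemma upto_in_NC_star: "d \<in> D \<Longrightarrow> t \<in> domain d \<Longrightarrow> upto d t \<in> NC_star X"
  using upto_in_NC_star_iff[of d t] domain_subset[of d] by blast

lemma topspace_hyper_C: "topspace (hyper_C_topology X) = hyper_C X"
proof -
  interpret M: Metric_space "hyper_C X" hausdorff_dist by (rule Metric_space_hyper_C[OF compact_X])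
  show ?thesis by (simp add: hyper_C_topology_def)
qed

lemma topspace_NC_star: "topspace (NC_star_topology X) = NC_star X"
  by (auto simp: NC_star_topology_def topspace_hyper_C NC_star_def)

lemma Hausdorff_hyper_C: "Hausdorff_space (hyper_C_topology X)"
proof -
  interpret M: Metric_space "hyper_C X" hausdorff_dist by (rule Metric_space_hyper_C[OF compact_X])
  show ?thesis by (simp add: hyper_C_topology_def M.Hausdorff_space_mtopology)
qed

text \<open>\<open>upto d\<close> is defined and continuous on the compact interval \<open>{0..1}\<close>, and \<open>domain d\<close> is the full
  preimage of \<^term>\<open>NC_star X\<close>; so the image of a relatively closed subset of \<open>domain d\<close> is the
  trace on \<^term>\<open>NC_star X\<close> of a compact set.\<close>

lemma upto_image_closedin:
  assumes "d \<in> D" "closedin (top_of_set (domain d)) S"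
  shows "closedin (NC_star_topology X) (upto d ` S)"
proof -
  obtain T where T: "closed T" "S = domain d \<inter> T" using assms(2) by (auto simp: closedin_closed)
  let ?K = "{0..1} \<inter> T"
  have "compactin (top_of_set {0..1}) ?K"
    using T by (simp add: compactin_subtopology compact_Int_closed)
  then have "compactin (hyper_C_topology X) (upto d ` ?K)"
    using upto_continuous[OF assms(1)] image_compactin by blast
  then have "closedin (hyper_C_topology X) (upto d ` ?K)"
    using Hausdorff_hyper_C compactin_imp_closedin by blast
  moreover have "upto d ` S = upto d ` ?K \<inter> NC_star X"
    using upto_in_NC_star_iff[OF assms(1)] domain_subset[of d] T(2) by auto
  ultimately show ?thesis unfolding NC_star_topology_def closedin_subtopology by blast
qed

lemma quotient_upto:
  assumes "to_end \<noteq> {}"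
  shows "quotient_map (sum_topology (\<lambda>d. top_of_set (domain d)) D) (NC_star_topology X) (\<lambda>(d, t). upto d t)"
    (is "quotient_map ?P _ ?F")
proof (rule continuous_closed_imp_quotient_map)
  have slice: "continuous_map (top_of_set (domain d)) (NC_star_topology X) (upto d)" if "d \<in> D" for d
    unfolding NC_star_topology_def
    using that upto_in_NC_star_iff[OF that] domain_subset[of d]
      continuous_map_from_subtopology_mono[OF upto_continuous[OF that] domain_subset[of d]]
    by (auto simp: continuous_map_in_subtopology)
  show "continuous_map ?P (NC_star_topology X) ?F"
    unfolding continuous_map_def
  proof (intro conjI allI impI)
    show "?F \<in> topspace ?P \<rightarrow> topspace (NC_star_topology X)"
      using upto_in_NC_star by (auto simp: topspace_NC_star)
    fix U assume U: "openin (NC_star_topology X) U"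
    have "openin (top_of_set (domain d)) {t. (d, t) \<in> {x \<in> topspace ?P. ?F x \<in> U}}" if "d \<in> D" for d
      using openin_continuous_map_preimage[OF slice[OF that] U] that by simp
    then show "openin ?P {x \<in> topspace ?P. ?F x \<in> U}"
      by (auto simp: openin_sum_topology)
  qed
  show "closed_map ?P (NC_star_topology X) ?F"
    unfolding closed_map_def
  proof (intro allI impI)
    fix C assume C: "closedin ?P C"
    then have sub: "C \<subseteq> Sigma D domain"
      and "\<forall>d\<in>D. closedin (top_of_set (domain d)) {t. (d, t) \<in> C}"
      by (auto simp: closedin_sum_topology comp_def)
    then have "\<forall>d\<in>D. closedin (NC_star_topology X) (upto d ` {t. (d, t) \<in> C})"
      using upto_image_closedin by simp
    moreover have "?F ` C = (\<Union>d\<in>D. upto d ` {t. (d, t) \<in> C})"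
    proof
      show "?F ` C \<subseteq> (\<Union>d\<in>D. upto d ` {t. (d, t) \<in> C})"
      proof
        fix B assume "B \<in> ?F ` C"
        then obtain d t where dt: "(d, t) \<in> C" "B = upto d t" by auto
        then have "d \<in> D" "B \<in> upto d ` {t. (d, t) \<in> C}" using sub by auto
        then show "B \<in> (\<Union>d\<in>D. upto d ` {t. (d, t) \<in> C})" by (intro UN_I)
      qed
    qed (auto intro!: image_eqI[of _ _ "(_, _)"])
    ultimately show "closedin (NC_star_topology X) (?F ` C)"
      using finite_D by (auto intro!: closedin_Union)
  qed
  show "?F ` topspace ?P = topspace (NC_star_topology X)"
  proof
    show "?F ` topspace ?P \<subseteq> topspace (NC_star_topology X)"
      using upto_in_NC_star by (auto simp: topspace_NC_star)
    show "topspace (NC_star_topology X) \<subseteq> ?F ` topspace ?P"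
    proof
      fix A assume "A \<in> topspace (NC_star_topology X)"
      then have A: "A \<in> NC_star X" by (simp add: topspace_NC_star)
      show "A \<in> ?F ` topspace ?P"
      proof (cases "A = X")
        case True
        obtain d where "d \<in> to_end" using assms by blast
        then have "(d, 1) \<in> topspace ?P" "?F (d, 1) = A"
          using upto_1 True by (auto simp: domain_def to_end_def)
        then show ?thesis by (metis image_eqI)
      next
        case False
        then obtain d t where "d \<in> D" "0 \<le> t" "t < 1" "A = upto d t" using NC_star_cases A by metis
        then have "(d, t) \<in> topspace ?P" "?F (d, t) = A" by (auto simp: domain_def)
        then show ?thesis by (metis image_eqI)
      qed
    qed
  qed
qed

end


section \<open>The model space as a quotient of the same sum of intervals\<close>

lemma homeomorphic_space_quotients:
  assumes "quotient_map P Y f" "quotient_map P Z g"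
    and "\<And>x y. x \<in> topspace P \<Longrightarrow> y \<in> topspace P \<Longrightarrow> f x = f y \<longleftrightarrow> g x = g y"
  shows "Y homeomorphic_space Z"
proof -
  obtain h where h: "continuous_map Y Z h" "\<And>x. x \<in> topspace P \<Longrightarrow> h (f x) = g x"
    using quotient_map_lift_exists[OF assms(1) quotient_imp_continuous_map[OF assms(2)]] assms(3)
    by metis
  obtain k where k: "continuous_map Z Y k" "\<And>x. x \<in> topspace P \<Longrightarrow> k (g x) = f x"
    using quotient_map_lift_exists[OF assms(2) quotient_imp_continuous_map[OF assms(1)]] assms(3)
    by metis
  have "topspace Y = f ` topspace P" "topspace Z = g ` topspace P"
    using assms(1,2) by (simp_all add: quotient_imp_surjective_map)
  then have "homeomorphic_maps Y Z h k"
    unfolding homeomorphic_maps_def using h k by auto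
  then show ?thesis unfolding homeomorphic_space_def by blast
qed

lemma openin_prod_discrete:
  "openin (prod_topology (discrete_topology A) T) W \<longleftrightarrow>
     W \<subseteq> A \<times> topspace T \<and> (\<forall>a\<in>A. openin T {t. (a, t) \<in> W})"
proof (intro iffI conjI ballI)
  assume W: "openin (prod_topology (discrete_topology A) T) W"
  then show sub: "W \<subseteq> A \<times> topspace T" using openin_subset by fastforce
  fix a assume "a \<in> A"
  then have "continuous_map T (prod_topology (discrete_topology A) T) (\<lambda>t. (a, t))"
    by (simp add: continuous_map_pairwise comp_def)
  from openin_continuous_map_preimage[OF this W] show "openin T {t. (a, t) \<in> W}"
    using sub by (auto elim!: back_subst[of "openin T"])
next
  assume W: "W \<subseteq> A \<times> topspace T \<and> (\<forall>a\<in>A. openin T {t. (a, t) \<in> W})"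
  then have "W = (\<Union>a\<in>A. {a} \<times> {t. (a, t) \<in> W})" by auto
  moreover have "openin (prod_topology (discrete_topology A) T) (\<Union>a\<in>A. {a} \<times> {t. (a, t) \<in> W})"
    using W by (intro openin_Union) (auto simp: openin_prod_Times_iff)
  ultimately show "openin (prod_topology (discrete_topology A) T) W" by simp
qed

lemma topspace_cone:
  "topspace (cone_topology Y) = cone_class Y ` (topspace Y \<times> {0..1})"
  using quotient_imp_surjective_map[OF quotient_map_cone_class[of Y]] by simp

text \<open>Openness in the model space, as in the sum of the intervals, is a condition on each interval
  separately. The parameter 1 corresponds to the apex of the cone, and so to the point \<open>X\<close> of the
  hyperspace.\<close>

lemma quotient_cone_plus_sum:
  fixes D :: "'d set" and n k :: nat
  assumes E: "E \<subseteq> D" and i: "bij_betw i E {..<n}" and j: "bij_betw j (D - E) {1..k}"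
  defines "I \<equiv> \<lambda>d. if d \<in> E then {0..1::real} else {0..<1}"
    and "Y \<equiv> discrete_topology {..<n}"
  shows "quotient_map (sum_topology (\<lambda>d. top_of_set (I d)) D)
    (plus_topology (cone_topology Y) (sum_topology (\<lambda>_. top_of_set {0..<1}) {1..k}))
    (\<lambda>(d, t). if d \<in> E then Inl (cone_class Y (i d, t)) else Inr (j d, t))"
    (is "quotient_map ?P (plus_topology ?C ?S) ?q")
  unfolding quotient_map_def
proof (intro conjI allI impI)
  have iE: "i ` E = {..<n}" and jE: "j ` (D - E) = {1..k}" using i j by (auto simp: bij_betw_def)
  have Ytop: "topspace Y = {..<n}" by (simp add: Y_def)
  have qE: "?q (d, t) = Inl (cone_class Y (i d, t))" if "d \<in> E" for d t using that by simp
  have qN: "?q (d, t) = Inr (j d, t)" if "d \<in> D - E" for d t using that by simp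
  have P: "topspace ?P = Sigma D I" by (simp add: comp_def)
  show top: "?q ` topspace ?P = topspace (plus_topology ?C ?S)"
  proof
    show "?q ` topspace ?P \<subseteq> topspace (plus_topology ?C ?S)"
    proof
      fix z assume "z \<in> ?q ` topspace ?P"
      then obtain d t where d: "d \<in> D" "t \<in> I d" "z = ?q (d, t)" unfolding P by auto
      show "z \<in> topspace (plus_topology ?C ?S)"
      proof (cases "d \<in> E")
        case True
        then have "(i d, t) \<in> topspace Y \<times> {0..1}" using d iE Ytop by (auto simp: I_def)
        then show ?thesis using d True by (auto simp: topspace_plus_topology topspace_cone)
      next
        case False
        then show ?thesis using d jE by (auto simp: topspace_plus_topology I_def)
      qed
    qed
    show "topspace (plus_topology ?C ?S) \<subseteq> ?q ` topspace ?P"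
    proof
      fix z assume z: "z \<in> topspace (plus_topology ?C ?S)"
      show "z \<in> ?q ` topspace ?P"
      proof (cases z)
        case (Inl c)
        then obtain a t where "a < n" "t \<in> {0..1}" "c = cone_class Y (a, t)"
          using z Ytop by (auto simp: topspace_plus_topology topspace_cone)
        moreover then obtain d where "d \<in> E" "a = i d" using iE by (metis imageE lessThan_iff)
        ultimately have "(d, t) \<in> topspace ?P" "z = ?q (d, t)" using E Inl by (auto simp: I_def)
        then show ?thesis by (rule image_eqI[rotated])
      next
        case (Inr c)
        then obtain a t where "a \<in> {1..k}" "t \<in> {0..<1}" "c = (a, t)"
          using z by (auto simp: topspace_plus_topology)
        moreover then obtain d where "d \<in> D - E" "a = j d" using jE by (metis imageE)
        ultimately have "(d, t) \<in> topspace ?P" "z = ?q (d, t)" using Inr by (auto simp: I_def)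
        then show ?thesis by (rule image_eqI[rotated])
      qed
    qed
  qed
  fix U assume U: "U \<subseteq> topspace (plus_topology ?C ?S)"
  have Usub: "Inl -` U \<subseteq> topspace ?C" "Inr -` U \<subseteq> topspace ?S"
    using U by (auto simp: topspace_plus_topology)
  have "openin ?P {x \<in> topspace ?P. ?q x \<in> U} \<longleftrightarrow>
      (\<forall>d\<in>D. openin (top_of_set (I d)) {t \<in> I d. ?q (d, t) \<in> U})"
    by (auto simp: openin_sum_topology comp_def)
  also have "\<dots> \<longleftrightarrow> (\<forall>d\<in>E. openin (top_of_set (I d)) {t \<in> I d. ?q (d, t) \<in> U}) \<and>
      (\<forall>d\<in>D - E. openin (top_of_set (I d)) {t \<in> I d. ?q (d, t) \<in> U})"
    using E by blast
  also have "(\<forall>d\<in>E. openin (top_of_set (I d)) {t \<in> I d. ?q (d, t) \<in> U}) \<longleftrightarrow>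
      (\<forall>a\<in>i ` E. openin (top_of_set {0..1}) {t \<in> {0..1}. cone_class Y (a, t) \<in> Inl -` U})"
    by (simp add: I_def)
  also have "\<dots> \<longleftrightarrow> openin ?C (Inl -` U)"
    using Usub(1) unfolding openin_cone_topology topspace_cone iE Ytop
    by (simp add: Y_def openin_prod_discrete)
  also have "(\<forall>d\<in>D - E. openin (top_of_set (I d)) {t \<in> I d. ?q (d, t) \<in> U}) \<longleftrightarrow>
      (\<forall>a\<in>j ` (D - E). openin (top_of_set {0..<1}) {t \<in> {0..<1}. Inr (a, t) \<in> U})"
    by (simp add: I_def)
  also have "\<dots> \<longleftrightarrow> (\<forall>a\<in>j ` (D - E). openin (top_of_set {0..<1}) {t. (a, t) \<in> Inr -` U})"
  proof (intro ball_cong refl)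
    fix a
    have "{t \<in> {0..<1}. Inr (a, t) \<in> U} = {t. (a, t) \<in> Inr -` U}" using Usub(2) by auto
    then show "openin (top_of_set {0..<1}) {t \<in> {0..<1}. Inr (a, t) \<in> U} \<longleftrightarrow>
      openin (top_of_set {0..<1}) {t. (a, t) \<in> Inr -` U}" by simp
  qed
  also have "\<dots> \<longleftrightarrow> openin ?S (Inr -` U)"
    using Usub(2) unfolding jE by (simp add: openin_sum_topology)
  finally show "openin ?P {x \<in> topspace ?P. ?q x \<in> U} \<longleftrightarrow> openin (plus_topology ?C ?S) U"
    by (simp add: openin_plus_topology)
qed

theorem theorem3p5:
  fixes X :: "'a::metric_space set" and m n :: nat
  assumes "is_tree X"
    and "\<not> X homeomorphic {0..1::real}"
    and "card (ramification_points X) = m"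
    and "card (endpoints X) = n"
  shows "\<exists>K :: (nat \<times> real) set topology.
    simple_nod n K \<and>
    NC_star_topology X homeomorphic_space
      plus_topology K (sum_topology (\<lambda>i. top_of_set {0..<1::real}) {1..n + 2 * m - 2})"
proof -
  obtain D where D: "arc_tree X D" "\<And>p. card (arc_tree.out_edges D p) \<noteq> 2"
    using reduced_arc_tree_exists[OF assms(1)] by blast
  have "X \<noteq> {}" using assms(1) by (auto simp: is_tree_def finite_graph_def continuum_def)
  interpret T: reduced_arc_tree X D
    using D \<open>X \<noteq> {}\<close> by (simp add: reduced_arc_tree_def reduced_arc_tree_axioms_def)
  have n: "3 \<le> n" using T.three_le_endpoints[OF assms(2)] assms(4) by simp
  let ?E = "T.to_end"
  have E: "?E \<subseteq> D" "card ?E = n" "finite ?E"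
    using T.card_edges_to_endpoints assms(4) T.finite_D by (auto simp: T.to_end_def)
  then have "card (D - ?E) = n + 2 * m - 2"
    using T.card_D T.finite_D assms(3,4) n by (simp add: card_Diff_subset)
  then obtain j where j: "bij_betw j (D - ?E) {1..n + 2 * m - 2}"
    using finite_same_card_bij[of "D - ?E" "{1..n + 2 * m - 2}"] T.finite_D by auto
  obtain i where i: "bij_betw i ?E {..<n}"
    using finite_same_card_bij[of ?E "{..<n}"] E by auto
  define Y where "Y = discrete_topology {..<n}"
  let ?P = "sum_topology (\<lambda>d. top_of_set (T.domain d)) D"
  let ?q = "\<lambda>(d, t). if d \<in> ?E then Inl (cone_class Y (i d, t)) else Inr (j d, t)"
  let ?Z = "plus_topology (cone_topology Y) (sum_topology (\<lambda>i. top_of_set {0..<1::real}) {1..n + 2 * m - 2})"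
  have "quotient_map ?P ?Z ?q"
    using quotient_cone_plus_sum[OF E(1) i j] unfolding T.domain_def Y_def .
  moreover have "?E \<noteq> {}" using E n by auto
  then have "quotient_map ?P (NC_star_topology X) (\<lambda>(d, t). T.upto d t)" by (rule T.quotient_upto)
  moreover have "(\<lambda>(d, t). T.upto d t) x = (\<lambda>(d, t). T.upto d t) y \<longleftrightarrow> ?q x = ?q y"
    if x: "x \<in> topspace ?P" and y: "y \<in> topspace ?P" for x y
  proof -
    obtain d t where dt: "x = (d, t)" "d \<in> D" "t \<in> T.domain d" using x by auto
    obtain e s where es: "y = (e, s)" "e \<in> D" "s \<in> T.domain e" using y by auto
    have t1: "d \<in> ?E" if "t = 1" using that dt by (auto simp: T.domain_def split: if_splits)
    have s1: "e \<in> ?E" if "s = 1" using that es by (auto simp: T.domain_def split: if_splits)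
    have t: "0 \<le> t" "t \<le> 1" and s: "0 \<le> s" "s \<le> 1"
      using dt es T.domain_subset by fastforce+
    have inj: "i d = i e \<longleftrightarrow> d = e" if "d \<in> ?E" "e \<in> ?E"
      using i that by (auto simp: bij_betw_def inj_on_def)
    have injj: "j d = j e \<longleftrightarrow> d = e" if "d \<notin> ?E" "e \<notin> ?E"
      using j that dt es by (auto simp: bij_betw_def inj_on_def)
    have cone1: "cone_class Y (a, 1) \<noteq> {(b, u)}" if "u \<noteq> 1" for a b and u :: real
      using that by (auto simp: cone_class_def)
    consider "t = 1" "s = 1" | "t = 1" "s < 1" | "t < 1" "s = 1" | "t < 1" "s < 1"
      using t s by linarith
    then have "T.upto d t = T.upto e s \<longleftrightarrow> ?q (d, t) = ?q (e, s)"
    proof cases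
      case 1
      then show ?thesis using t1 s1 T.upto_1 by (simp add: cone_class_def)
    next
      case 2
      then have "T.upto d t \<noteq> T.upto e s" using t1 T.upto_1 T.upto_neq_X[of e s] es s by auto
      moreover have "?q (d, t) \<noteq> ?q (e, s)"
        using 2 t1 cone1[of s] by (auto simp: cone_class_def[of _ "(i e, s)"])
      ultimately show ?thesis by simp
    next
      case 3
      then have "T.upto d t \<noteq> T.upto e s" using s1 T.upto_1 T.upto_neq_X[of d t] dt t by auto
      moreover have "?q (d, t) \<noteq> ?q (e, s)"
        using 3 s1 cone1[of t, symmetric] by (auto simp: cone_class_def[of _ "(i d, t)"])
      ultimately show ?thesis by simp
    next
      case 4
      then have "T.upto d t = T.upto e s \<longleftrightarrow> d = e \<and> t = s"
        using T.upto_inj dt es t s by blast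
      moreover have "?q (d, t) = ?q (e, s) \<longleftrightarrow> d = e \<and> t = s"
        using 4 inj injj by (auto simp: cone_class_def)
      ultimately show ?thesis by simp
    qed
    then show ?thesis using dt es by simp
  qed
  ultimately have "NC_star_topology X homeomorphic_space ?Z"
    by (intro homeomorphic_space_quotients)
  moreover have "simple_nod n (cone_topology Y)"
    using n homeomorphic_space_refl by (auto simp: simple_nod_def Y_def)
  ultimately show ?thesis by blast
qed

end
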